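(* Let $p,q\in\mathbb N$ and let $T$ be a bounded semi-infinite real banded matrix with $p$ subdiagonals and $q$ superdiagonals that has a positive bidiagonal factorization. Let the initial condition matrices satisfy $\nu^{-\top}=\Lambda\mathcal A$, $\xi^{-1}=\mathcal B\Upsilon$ with $\mathcal A\in\mathbb R^{p\times p}$ nonnegative upper unitriangular and $\mathcal B\in\mathbb R^{q\times q}$ nonnegative lower unitriangular. Let $\psi_{b,a}$, $a\in\{1,\dots,p\}$, $b\in\{1,\dots,q\}$, be nondecreasing functions whose Lebesgue--Stieltjes measures $\mathrm d\psi_{b,a}$ are supported on $\Delta$ and satisfy $\sum_{a=1}^p\sum_{b=1}^q\int_\Delta B^{(b)}_l(x)\,\mathrm d\psi_{b,a}(x)A^{(a)}_k(x)=\delta_{k,l}$ for all $k,l\in\mathbb N_0$. Let $N\ge\max(p,q)$. Then, for $a\in\{1,\dots,p\}$ and $b\in\{1,\dots,q\}$, $$\int_\Delta x^n\,\mathrm d\psi_{b,a}(x)=\sum_{k=1}^{N+1}\rho^{[N]}_{k,b}\,\mu^{[N]}_{k,a}\big(\lambda^{[N]}_k\big)^n,\qquad 0\le n\le d_{b,a}(N).$$ Moreover the degrees of precision $d_{b,a}(N)$ are optimal: for every power $n>d_{b,a}(N)$ a positive remainder appears, i.e. $\int_\Delta x^n\,\mathrm d\psi_{b,a}(x)-\sum_{k=1}^{N+1}\rho^{[N]}_{k,b}\mu^{[N]}_{k,a}(\lambda^{[N]}_k)^n>0$.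
   Context: $\mathbb N=\{1,2,\dots\}$, $\mathbb N_0=\{0,1,2,\dots\}$. Banded: $T=(T_{i,j})_{i,j\in\mathbb N_0}$ with $T_{i,j}=0$ if $i-j>p$ or $j-i>q$, and $T_{n+p,n}\neq0$, $T_{n,n+q}\ne0$ for all $n$. Bounded: $\|T\|_\infty=\sup_i\sum_j|T_{i,j}|<\infty$. For any semi-infinite matrix $M$, $M^{[N]}=(M_{i,j})_{0\le i,j\le N}$. $P_{N+1}(x)=\det(xI_{N+1}-T^{[N]})$, with zeros $\lambda^{[N]}_1>\dots>\lambda^{[N]}_{N+1}$ (under a PBF they are distinct positive numbers). $\Delta$ is the smallest closed interval containing all eigenvalues of all $T^{[N]}$, $N\in\mathbb N_0$. Recursion polynomials: for lower unitriangular $\nu\in\mathbb R^{p\times p}$, $\xi\in\mathbb R^{q\times q}$, $A^{(a)}_n(x)$ is determined by $A^{(a)}_{i-1}=\nu_{i,a}$ ($1\le i\le p$) and $\sum_{m=\max(0,n-q)}^{n+p}A^{(a)}_mT_{m,n}=xA^{(a)}_n$ ($n\in\mathbb N_0$); $B^{(b)}_n(x)$ is determined by $B^{(b)}_{i-1}=\xi_{i,b}$ ($1\le i\le q$) and $\sum_{m=\max(0,n-p)}^{n+q}T_{n,m}B^{(b)}_m=xB^{(b)}_n$ ($n\in\mathbb N_0$). Positive bidiagonal factorization (PBF): $T=L_1\cdots L_p\,D\,U_q\cdots U_1$, where $D=\mathrm{diag}(D_0,D_1,\dots)$, $L_k$ is lower bidiagonal with unit diagonal and subdiagonal entries $(L_k)_{i+1,i}=L_{k|i}$,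 $U_k$ is upper bidiagonal with unit diagonal and superdiagonal entries $(U_k)_{i,i+1}=U_{k|i}$, and $L_{k|i},U_{k|i},D_i>0$ for all $i\in\mathbb N_0$. $\Lambda\in\mathbb R^{p\times p}$ has columns $\Lambda^{(1)}=e_1$, $\Lambda^{(k)}=\frac1{r_k}L_1^{[p-1]}\cdots L_{k-1}^{[p-1]}e_1$, $r_k=L_{k-1|0}L_{k-2|1}\cdots L_{1|k-2}$ ($2\le k\le p$); $\Upsilon\in\mathbb R^{q\times q}$ has rows $\Upsilon^{(1)}=e_1^\top$, $\Upsilon^{(k)}=\frac1{s_k}e_1^\top U_{k-1}^{[q-1]}\cdots U_1^{[q-1]}$, $s_k=U_{k-1|0}U_{k-2|1}\cdots U_{1|k-2}$ ($2\le k\le q$), where $e_1$ is the first canonical column vector. Christoffel numbers: $\beta_N=(-1)^{(q-1)N}T_{0,q}\cdots T_{N-1,N+q-1}$ ($\beta_0=1$). $Q_{n,N}$ is the $p\times p$ determinant whose first row is $(A^{(1)}_n,\dots,A^{(p)}_n)$ and whose following rows are $(A^{(1)}_{N+i},\dots,A^{(p)}_{N+i})$, $i=1,\dots,p-1$; $R_{n,N}$ is the $q\times q$ determinant whose first row is $(B^{(1)}_n,\dots,B^{(q)}_n)$ and whose following rows are $(B^{(1)}_{N+i},\dots,B^{(q)}_{N+i})$, $i=1,\dots,q-1$. With all polynomials evaluated at $\lambda^{[N]}_k$ and empty determinants equal to $1$, $$\mu^{[N]}_{k,a}=(-1)^{a-1}\frac{\det\big(A^{(c)}_{N+i}\big)_{1\le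 i\le p-1,\ c\in\{1,\dots,p\}\setminus\{a\}}}{\beta_N\sum_{l=0}^NQ_{l,N}R_{l,N}},\qquad \rho^{[N]}_{k,b}=(-1)^{b-1}\beta_N\det\big(B^{(c)}_{N+i}\big)_{1\le i\le q-1,\ c\in\{1,\dots,q\}\setminus\{b\}}.$$ Degrees of precision: let $e^\nu_a$ be the column vector whose first $p$ entries form the $a$-th column of $\nu^{-\top}$ and whose other entries are $0$, and $(e^\xi_b)^\top$ the row vector whose first $q$ entries form the $b$-th row of $\xi^{-1}$ and whose other entries are $0$ (semi-infinite when multiplied with $T^n$, of size $N+1$ when multiplied with $(T^{[N]})^n$). $d_{b,a}(N)$ is the largest natural number such that $(e^\xi_b)^\top T^ne^\nu_a=(e^\xi_b)^\top(T^{[N]})^ne^\nu_a$ for all $0\le n\le d_{b,a}(N)$. Its value is $d_{b,a}(N)=\lceil\frac{N+2-a}{p}\rceil+\lceil\frac{N+2-b}{q}\rceil-1$. *)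

theory Defs
  imports
    "HOL-Analysis.Lebesgue_Measure"
    "HOL-Analysis.Set_Integral"
    "Jordan_Normal_Form.Char_Poly"
    "Jordan_Normal_Form.Gauss_Jordan_Elimination"
begin

text \<open>
  Semi-infinite matrices are functions on pairs of natural numbers, rows first, indexed from 0.
  Finite matrices are those of Jordan_Normal_Form, whose entries are also indexed from 0. The labels
  \<open>a\<close>, \<open>b\<close>, \<open>k\<close> of columns, rows, bidiagonal factors and zeros run from 1, so that column \<open>a\<close> of a
  finite matrix has library index \<open>a - 1\<close>.
\<close>

type_synonym semi_mat = "nat \<Rightarrow> nat \<Rightarrow> real"


subsection \<open>Semi-infinite matrices\<close>

text \<open>
  For banded matrices, and for vectors of finite support, the series below have only finitely many
  nonzero terms.
\<close>

definition semi_id :: semi_mat where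
  "semi_id i j = (if i = j then 1 else 0)"

definition semi_mult :: "semi_mat \<Rightarrow> semi_mat \<Rightarrow> semi_mat" where
  "semi_mult M K i j = (\<Sum>l. M i l * K l j)"

definition semi_prod :: "semi_mat list \<Rightarrow> semi_mat" where
  "semi_prod Ms = foldr semi_mult Ms semi_id"

definition semi_pow :: "semi_mat \<Rightarrow> nat \<Rightarrow> semi_mat" where
  "semi_pow M n = semi_prod (replicate n M)"

definition semi_form :: "(nat \<Rightarrow> real) \<Rightarrow> semi_mat \<Rightarrow> (nat \<Rightarrow> real) \<Rightarrow> real" where
  "semi_form u M v = (\<Sum>i. \<Sum>j. u i * M i j * v j)"

text \<open>\<open>trunc M N\<close> is $M^{[N]}$, of size \<open>N + 1\<close>.\<close>

definition trunc :: "semi_mat \<Rightarrow> nat \<Rightarrow> real mat" where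
  "trunc M N = mat (N + 1) (N + 1) (\<lambda>(i, j). M i j)"

definition banded :: "nat \<Rightarrow> nat \<Rightarrow> semi_mat \<Rightarrow> bool" where
  "banded p q T \<longleftrightarrow>
     (\<forall>i j. i > j + p \<or> j > i + q \<longrightarrow> T i j = 0) \<and>
     (\<forall>n. T (n + p) n \<noteq> 0) \<and> (\<forall>n. T n (n + q) \<noteq> 0)"

definition bounded_semi :: "semi_mat \<Rightarrow> bool" where
  "bounded_semi T \<longleftrightarrow>
     (\<forall>i. summable (\<lambda>j. \<bar>T i j\<bar>)) \<and> bdd_above (range (\<lambda>i. \<Sum>j. \<bar>T i j\<bar>))"


subsection \<open>Positive bidiagonal factorizations\<close>

text \<open>\<open>L k i\<close> and \<open>U k i\<close> are the entries $L_{k|i}$ and $U_{k|i}$.\<close>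

definition lower_bidiag :: "(nat \<Rightarrow> real) \<Rightarrow> semi_mat" where
  "lower_bidiag l i j = (if i = j then 1 else if i = j + 1 then l j else 0)"

definition upper_bidiag :: "(nat \<Rightarrow> real) \<Rightarrow> semi_mat" where
  "upper_bidiag u i j = (if i = j then 1 else if j = i + 1 then u i else 0)"

definition semi_diag :: "(nat \<Rightarrow> real) \<Rightarrow> semi_mat" where
  "semi_diag D i j = (if i = j then D i else 0)"

definition is_PBF ::
  "nat \<Rightarrow> nat \<Rightarrow> semi_mat \<Rightarrow> (nat \<Rightarrow> nat \<Rightarrow> real) \<Rightarrow> (nat \<Rightarrow> real) \<Rightarrow> (nat \<Rightarrow> nat \<Rightarrow> real) \<Rightarrow> bool" where
  "is_PBF p q T L D U \<longleftrightarrow>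
     (\<forall>k\<in>{1..p}. \<forall>i. L k i > 0) \<and> (\<forall>k\<in>{1..q}. \<forall>i. U k i > 0) \<and> (\<forall>i. D i > 0) \<and>
     T = semi_prod (map (\<lambda>k. lower_bidiag (L k)) [1..<p + 1] @ [semi_diag D] @
                    map (\<lambda>k. upper_bidiag (U k)) (rev [1..<q + 1]))"


subsection \<open>Initial conditions\<close>

definition mat_prod :: "nat \<Rightarrow> real mat list \<Rightarrow> real mat" where
  "mat_prod n Ms = foldr (*) Ms (1\<^sub>m n)"

text \<open>Column 0 of a matrix $M$ is $M e_1$ and row 0 is $e_1^\top M$.\<close>

definition Lambda_mat :: "nat \<Rightarrow> (nat \<Rightarrow> nat \<Rightarrow> real) \<Rightarrow> real mat" where
  "Lambda_mat p L = mat_of_cols p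
     (map (\<lambda>k. (1 / (\<Prod>j = 1..<k. L j (k - 1 - j))) \<cdot>\<^sub>v
               col (mat_prod p (map (\<lambda>j. trunc (lower_bidiag (L j)) (p - 1)) [1..<k])) 0)
          [1..<p + 1])"

definition Upsilon_mat :: "nat \<Rightarrow> (nat \<Rightarrow> nat \<Rightarrow> real) \<Rightarrow> real mat" where
  "Upsilon_mat q U = mat_of_rows q
     (map (\<lambda>k. (1 / (\<Prod>j = 1..<k. U j (k - 1 - j))) \<cdot>\<^sub>v
               row (mat_prod q (map (\<lambda>j. trunc (upper_bidiag (U j)) (q - 1)) (rev [1..<k]))) 0)
          [1..<q + 1])"

definition upper_unitriangular :: "nat \<Rightarrow> real mat \<Rightarrow> bool" where
  "upper_unitriangular n M \<longleftrightarrow>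
     M \<in> carrier_mat n n \<and> upper_triangular M \<and> (\<forall>i<n. M $$ (i, i) = 1)"

definition lower_unitriangular :: "nat \<Rightarrow> real mat \<Rightarrow> bool" where
  "lower_unitriangular n M \<longleftrightarrow> upper_unitriangular n (transpose_mat M)"

definition nonneg_mat :: "real mat \<Rightarrow> bool" where
  "nonneg_mat M \<longleftrightarrow> (\<forall>i<dim_row M. \<forall>j<dim_col M. M $$ (i, j) \<ge> 0)"

text \<open>The library inverse is \<open>None\<close> on singular matrices; unitriangular ones are invertible.\<close>

definition mat_inv :: "real mat \<Rightarrow> real mat" where
  "mat_inv M = the (mat_inverse M)"


subsection \<open>Recursion polynomials\<close>

text \<open>
  \<open>A a n\<close> is $A^{(a)}_n$ and \<open>B b n\<close> is $B^{(b)}_n$; truncated subtraction turns \<open>n - q\<close> into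
  $\max(0, n - q)$. As the extreme diagonals of \<open>T\<close> do not vanish, these conditions have exactly one
  solution for labels \<open>a \<in> {1..p}\<close>, \<open>b \<in> {1..q}\<close>.
\<close>

definition recursion_A ::
  "nat \<Rightarrow> nat \<Rightarrow> semi_mat \<Rightarrow> real mat \<Rightarrow> (nat \<Rightarrow> nat \<Rightarrow> real poly) \<Rightarrow> bool" where
  "recursion_A p q T \<nu> A \<longleftrightarrow>
     (\<forall>a\<in>{1..p}. (\<forall>i\<in>{1..p}. A a (i - 1) = [:\<nu> $$ (i - 1, a - 1):]) \<and>
        (\<forall>n. (\<Sum>m = n - q..n + p. Polynomial.smult (T m n) (A a m)) = [:0, 1:] * A a n))"

definition recursion_B ::
  "nat \<Rightarrow> nat \<Rightarrow> semi_mat \<Rightarrow> real mat \<Rightarrow> (nat \<Rightarrow> nat \<Rightarrow> real poly) \<Rightarrow> bool" where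
  "recursion_B p q T \<xi> B \<longleftrightarrow>
     (\<forall>b\<in>{1..q}. (\<forall>i\<in>{1..q}. B b (i - 1) = [:\<xi> $$ (i - 1, b - 1):]) \<and>
        (\<forall>n. (\<Sum>m = n - p..n + q. Polynomial.smult (T n m) (B b m)) = [:0, 1:] * B b n))"


subsection \<open>Zeros and Christoffel numbers\<close>

text \<open>
  \<open>zero_of T N k\<close> is $\lambda^{[N]}_k$, the \<open>k\<close>-th largest real zero of $P_{N+1}$. A positive
  bidiagonal factorization makes the \<open>N + 1\<close> zeros real and simple.
\<close>

definition zero_of :: "semi_mat \<Rightarrow> nat \<Rightarrow> nat \<Rightarrow> real" where
  "zero_of T N k = rev (sorted_list_of_set {x. poly (char_poly (trunc T N)) x = 0}) ! (k - 1)"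

definition beta_coeff :: "nat \<Rightarrow> semi_mat \<Rightarrow> nat \<Rightarrow> real" where
  "beta_coeff q T N = (-1) ^ ((q - 1) * N) * (\<Prod>i<N. T i (i + q))"

text \<open>
  \<open>first_row_det r C n N\<close> is $Q_{n,N}$ for \<open>r = p\<close>, \<open>C = A\<close>, and $R_{n,N}$ for \<open>r = q\<close>, \<open>C = B\<close>.
  \<open>omit_col_det r C c N\<close> has as columns the labels from \<open>1\<close> to \<open>r\<close> other than \<open>c\<close>.
\<close>

definition first_row_det :: "nat \<Rightarrow> (nat \<Rightarrow> nat \<Rightarrow> real poly) \<Rightarrow> nat \<Rightarrow> nat \<Rightarrow> real poly" where
  "first_row_det r C n N = det (mat r r (\<lambda>(i, j). C (j + 1) (if i = 0 then n else N + i)))"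

definition omit_col_det :: "nat \<Rightarrow> (nat \<Rightarrow> nat \<Rightarrow> real poly) \<Rightarrow> nat \<Rightarrow> nat \<Rightarrow> real poly" where
  "omit_col_det r C c N =
     det (mat (r - 1) (r - 1) (\<lambda>(i, j). C (if j + 1 < c then j + 1 else j + 2) (N + (i + 1))))"

definition christoffel_mu ::
  "nat \<Rightarrow> nat \<Rightarrow> semi_mat \<Rightarrow> (nat \<Rightarrow> nat \<Rightarrow> real poly) \<Rightarrow> (nat \<Rightarrow> nat \<Rightarrow> real poly) \<Rightarrow>
     nat \<Rightarrow> nat \<Rightarrow> nat \<Rightarrow> real" where
  "christoffel_mu p q T A B N k a =
     (-1) ^ (a - 1) * poly (omit_col_det p A a N) (zero_of T N k) /
       (beta_coeff q T N *
        (\<Sum>l = 0..N. poly (first_row_det p A l N) (zero_of T N k) *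
                    poly (first_row_det q B l N) (zero_of T N k)))"

definition christoffel_rho ::
  "nat \<Rightarrow> semi_mat \<Rightarrow> (nat \<Rightarrow> nat \<Rightarrow> real poly) \<Rightarrow> nat \<Rightarrow> nat \<Rightarrow> nat \<Rightarrow> real" where
  "christoffel_rho q T B N k b =
     (-1) ^ (b - 1) * beta_coeff q T N * poly (omit_col_det q B b N) (zero_of T N k)"


subsection \<open>Degrees of precision\<close>

definition e_nu :: "nat \<Rightarrow> real mat \<Rightarrow> nat \<Rightarrow> nat \<Rightarrow> real" where
  "e_nu p \<nu> a i = (if i < p then mat_inv (transpose_mat \<nu>) $$ (i, a - 1) else 0)"

definition e_xi :: "nat \<Rightarrow> real mat \<Rightarrow> nat \<Rightarrow> nat \<Rightarrow> real" where
  "e_xi q \<xi> b i = (if i < q then mat_inv \<xi> $$ (b - 1, i) else 0)"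

text \<open>
  Under a positive bidiagonal factorization and nonnegative initial conditions, for
  \<open>N \<ge> max p q\<close>, the maximum is attained and equals
  $\lceil (N+2-a)/p \rceil + \lceil (N+2-b)/q \rceil - 1$.
\<close>

definition precision_degree ::
  "nat \<Rightarrow> nat \<Rightarrow> semi_mat \<Rightarrow> real mat \<Rightarrow> real mat \<Rightarrow> nat \<Rightarrow> nat \<Rightarrow> nat \<Rightarrow> nat" where
  "precision_degree p q T \<nu> \<xi> b a N = (GREATEST d. \<forall>n\<le>d.
     semi_form (e_xi q \<xi> b) (semi_pow T n) (e_nu p \<nu> a) =
     scalar_prod (vec (N + 1) (e_xi q \<xi> b)) ((trunc T N ^\<^sub>m n) *\<^sub>v vec (N + 1) (e_nu p \<nu> a)))"


subsection \<open>Spectral interval and Stieltjes measures\<close>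

text \<open>
  Only real eigenvalues are collected, which is all of them under a positive bidiagonal
  factorization.
\<close>

definition Delta :: "semi_mat \<Rightarrow> real set" where
  "Delta T = \<Inter>{I. closed I \<and> is_interval I \<and> (\<forall>N x. eigenvalue (trunc T N) x \<longrightarrow> x \<in> I)}"

text \<open>
  The library's \<open>interval_measure\<close> expects a right-continuous function. The Lebesgue--Stieltjes
  measure of a nondecreasing \<open>F\<close> gives \<open>{x<..y}\<close> the mass $F(y+) - F(x+)$, so \<open>F\<close> is first replaced
  by its right limits, which changes nothing if \<open>F\<close> is right-continuous.
\<close>

definition stieltjes_measure :: "(real \<Rightarrow> real) \<Rightarrow> real measure" where
  "stieltjes_measure F = interval_measure (\<lambda>x. Lim (at_right x) F)"

definition measure_supported_on :: "real measure \<Rightarrow> real set \<Rightarrow> bool" where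
  "measure_supported_on M S \<longleftrightarrow> emeasure M (- S) = 0"

end

theory Submission
  imports Defs "HOL-Analysis.Function_Topology"
begin

text \<open>
  Write $u$ for \<open>e_xi q \<xi> b\<close> and $v$ for \<open>e_nu p \<nu> a\<close>. Both sides of the quadrature formula are matrix
  moments. Multiplication by $x$ acts on the polynomials $B^{(b)}_n$ as $T$, so biorthogonality of the
  measures gives $\int x^n\,d\psi_{b,a} = u^\top T^n v$ (\<open>moments_eq_form\<close>). The Christoffel sum is
  $u^\top (T^{[N]})^n v$ (\<open>christoffel_quadrature\<close>): it is the spectral decomposition of the
  truncation, because $(Q_{l,N})_{l\le N}$ and $(R_{l,N})_{l\le N}$, evaluated at a zero, are left and
  right eigenvectors, whose pairings with $v$ and $u$ are the signed minors in $\mu$ and $\rho$.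

  For this the truncation must have $N+1$ distinct real eigenvalues, and the determinants must not
  vanish identically at any of them. Both follow from the spectral theory of a product of bidiagonal matrices
  with positive entries that contains a lower and an upper factor (\<open>bidiag_prod_spectrum\<close>), proved by
  deflation. Such a product is a primitive nonnegative matrix, so it has a positive left Perron vector
  $w$. On the invariant hyperplane $w\cdot x=0$ use the partial sums $s_i=\sum_{j\le i}w_jx_j$ as
  coordinates: each bidiagonal factor becomes a bidiagonal factor with positive entries of size one
  less. Hence induction on the size gives the spectrum, the Perron root being simple and new. It also
  shows that the last component of an eigenvector is nonzero, since on the hyperplane this component
  is $-s_{n-1}/w_n$, for matrices of size $n+1$. The determinants do not vanish identically at an
  eigenvalue, as otherwise some left eigenvector would end in $0$
  (\<open>first_row_det_eigenvec\<close>).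

  The remainder $u^\top T^n v-u^\top (T^{[N]})^n v$ is the weight of the paths of length $n$ that leave
  $\{0,\dots,N\}$. All weights are nonnegative, so it is at least $0$. It is positive for some $n$,
  because the path from $0$ to $N+1$ and back has positive weight and $u_0,v_0>0$, and it stays positive
  for all larger $n$, because positive diagonal entries allow the path to wait. So the remainder
  vanishes exactly up to the degree of precision (\<open>precision_degree_dichotomy\<close>).
\<close>

section \<open>Leading sections of infinite matrices\<close>

definition trunc_app :: "nat \<Rightarrow> semi_mat \<Rightarrow> (nat \<Rightarrow> real) \<Rightarrow> nat \<Rightarrow> real" where
  "trunc_app n M x i = (\<Sum>j<n. M i j * x j)"

definition trunc_mult :: "nat \<Rightarrow> semi_mat \<Rightarrow> semi_mat \<Rightarrow> semi_mat" where
  "trunc_mult n F G i j = (\<Sum>l<n. F i l * G l j)"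

definition transposed :: "semi_mat \<Rightarrow> semi_mat" where
  "transposed M i j = M j i"

lemma trunc_app_mult: "trunc_app n (trunc_mult n F G) x i = trunc_app n F (trunc_app n G x) i"
  unfolding trunc_app_def trunc_mult_def sum_distrib_left sum_distrib_right
  by (subst sum.swap) (simp add: mult.assoc)

lemma trunc_app_cong:
  assumes "\<And>j. j < n \<Longrightarrow> M i j = M' i j" "\<And>j. j < n \<Longrightarrow> x j = x' j"
  shows "trunc_app n M x i = trunc_app n M' x' i"
  using assms by (simp add: trunc_app_def)

lemma trunc_app_combine: "trunc_app n M (\<lambda>j. a * x j + b * y j) i = a * trunc_app n M x i + b * trunc_app n M y i"
  by (simp add: trunc_app_def sum.distrib sum_distrib_left algebra_simps)

lemma trunc_app_adjoint: "(\<Sum>i<n. w i * trunc_app n M x i) = (\<Sum>j<n. trunc_app n (transposed M) w j * x j)"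
  unfolding trunc_app_def transposed_def sum_distrib_left sum_distrib_right
  by (subst sum.swap) (simp add: mult_ac)

lemma trunc_app_pow_eigen:
  assumes "\<And>i. i < n \<Longrightarrow> trunc_app n M x i = r * x i"
  shows "i < n \<Longrightarrow> (trunc_app n M ^^ k) x i = r ^ k * x i"
proof (induction k arbitrary: i)
  case (Suc k)
  have "trunc_app n M ((trunc_app n M ^^ k) x) i = trunc_app n M (\<lambda>j. r ^ k * x j + 0 * x j) i"
    using Suc by (intro trunc_app_cong) auto
  then show ?case using Suc.prems assms by (simp only: trunc_app_combine funpow.simps o_apply) simp
qed simp

section \<open>Perron vectors\<close>

text \<open>
  Positivity next to the diagonal connects all indices, and positivity on the diagonal lets a path
  wait, so that the \<open>n\<close>-th power has only positive entries.
\<close>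

definition connected_kernel :: "nat \<Rightarrow> semi_mat \<Rightarrow> bool" where
  "connected_kernel n M \<longleftrightarrow> (\<forall>i<n. \<forall>j<n. M i j \<ge> 0) \<and>
     (\<forall>i<n. M i i > 0) \<and> (\<forall>i. Suc i < n \<longrightarrow> M i (Suc i) > 0 \<and> M (Suc i) i > 0)"

lemma connected_kernel_pos:
  assumes "connected_kernel n M" "i < n" "j < n" "i \<le> Suc j" "j \<le> Suc i"
  shows "M i j > 0"
proof -
  consider "i = j" | "i = Suc j" | "j = Suc i" using assms by linarith
  then show ?thesis using assms unfolding connected_kernel_def by cases auto
qed

lemma trunc_app_pow_nonneg:
  assumes "connected_kernel n M" "\<And>i. i < n \<Longrightarrow> x i \<ge> 0"
  shows "i < n \<Longrightarrow> (trunc_app n M ^^ k) x i \<ge> 0"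
proof (induction k arbitrary: i)
  case (Suc k)
  then show ?case using assms(1) by (auto simp: trunc_app_def connected_kernel_def intro!: sum_nonneg)
qed (use assms in simp)

lemma trunc_app_pow_pos:
  assumes M: "connected_kernel n M" and x: "\<And>i. i < n \<Longrightarrow> x i \<ge> 0" and j: "j < n" "x j > 0"
  shows "i < n \<Longrightarrow> i \<le> j + k \<Longrightarrow> j \<le> i + k \<Longrightarrow> (trunc_app n M ^^ k) x i > 0"
proof (induction k arbitrary: i)
  case (Suc k)
  define l where "l = (if i < j then Suc i else if j < i then i - 1 else i)"
  have l: "l < n" "l \<le> j + k" "j \<le> l + k" "i \<le> Suc l" "l \<le> Suc i"
    using Suc.prems j by (auto simp: l_def)
  have "0 < M i l * (trunc_app n M ^^ k) x l"
    using connected_kernel_pos[OF M Suc.prems(1) l(1) l(4,5)] Suc.IH[OF l(1-3)] by simp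
  also have "\<dots> \<le> trunc_app n M ((trunc_app n M ^^ k) x) i"
    unfolding trunc_app_def[of n M "(trunc_app n M ^^ k) x"]
    using M trunc_app_pow_nonneg[where x = x and k = k, OF M x] Suc.prems(1) l(1)
    by (intro member_le_sum) (auto simp: connected_kernel_def)
  finally show ?case by simp
qed (use j in auto)

lemma trunc_app_pow_pos_all:
  assumes "connected_kernel n M" "\<And>i. i < n \<Longrightarrow> x i \<ge> 0" "j < n" "x j > 0" "i < n"
  shows "(trunc_app n M ^^ n) x i > 0"
  using trunc_app_pow_pos[where x = x and i = i and k = n, OF assms(1-4)] assms(3,5) by auto

lemma compact_unit_cube: "compact {x :: nat \<Rightarrow> real. \<forall>i. x i \<in> {0..1}}"
proof -
  have "compactin (product_topology (\<lambda>i :: nat. euclidean) UNIV)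
          (PiE UNIV (\<lambda>i. {0..1 :: real}))"
    by (subst compactin_PiE) auto
  then show ?thesis
    by (simp add: euclidean_product_topology PiE_def Pi_def extensional_def)
qed

text \<open>
  Collatz--Wielandt: take the largest \<open>r\<close> for which some probability vector \<open>x\<close> satisfies
  \<open>r x \<le> M x\<close>; it exists by compactness. If the inequality were strict somewhere, applying the
  \<open>n\<close>-th power of \<open>M\<close> would make it strict everywhere, and \<open>r\<close> could be increased.
\<close>

lemma perron_vector:
  assumes M: "connected_kernel n M" and n: "n > 0"
  shows "\<exists>r v. r > 0 \<and> (\<forall>i<n. v i > 0) \<and> (\<forall>i<n. trunc_app n M v i = r * v i)"
proof -
  have Mnn: "M i j \<ge> 0" if "i < n" "j < n" for i j
    using M that by (simp add: connected_kernel_def)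
  define R where "R = (\<Sum>i<n. \<Sum>j<n. M i j)"
  \<comment> \<open>The bound \<open>r \<le> R\<close> follows from the other conditions; stating it makes \<open>S\<close> visibly compact.\<close>
  define S where "S = {(r :: real, x :: nat \<Rightarrow> real). 0 \<le> r \<and> r \<le> R \<and> (\<forall>i. x i \<in> {0..1}) \<and>
     (\<Sum>i<n. x i) = 1 \<and> (\<forall>i<n. r * x i \<le> (\<Sum>j<n. M i j * x j))}"
  have bound: "r \<le> R" if x: "\<And>i. x i \<in> {0..1 :: real}" "(\<Sum>i<n. x i) = 1"
    "\<And>i. i < n \<Longrightarrow> r * x i \<le> (\<Sum>j<n. M i j * x j)" for r x
  proof -
    have "r = (\<Sum>i<n. r * x i)" using x(2) by (simp flip: sum_distrib_left)
    also have "\<dots> \<le> (\<Sum>i<n. \<Sum>j<n. M i j * x j)" using x(3) by (intro sum_mono) auto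
    also have "\<dots> \<le> R" unfolding R_def
      using x(1) Mnn by (intro sum_mono) (auto intro!: mult_left_le)
    finally show ?thesis .
  qed
  have cont: "continuous_on UNIV (\<lambda>z :: real \<times> (nat \<Rightarrow> real). snd z i)" for i
    by (intro continuous_on_compose2[OF continuous_on_product_coordinates continuous_on_snd])
       (auto intro: continuous_intros)
  have "closed ({z :: real \<times> (nat \<Rightarrow> real). (\<Sum>i<n. snd z i) = 1} \<inter>
     (\<Inter>i\<in>{..<n}. {z. fst z * snd z i \<le> (\<Sum>j<n. M i j * snd z j)}))"
    by (intro closed_Int closed_INT ballI closed_Collect_eq closed_Collect_le continuous_intros cont)
  moreover have "compact ({0..R} \<times> {x :: nat \<Rightarrow> real. \<forall>i. x i \<in> {0..1}})"
    by (intro compact_Times compact_unit_cube) auto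
  moreover have "S = ({0..R} \<times> {x :: nat \<Rightarrow> real. \<forall>i. x i \<in> {0..1}}) \<inter>
     ({z. (\<Sum>i<n. snd z i) = 1} \<inter> (\<Inter>i\<in>{..<n}. {z. fst z * snd z i \<le> (\<Sum>j<n. M i j * snd z j)}))"
    by (auto simp: S_def)
  ultimately have "compact S" by (simp only: compact_Int_closed)
  moreover have "(0, \<lambda>i. if i = 0 then 1 else 0) \<in> S"
    using n Mnn by (auto simp: S_def R_def intro!: sum_nonneg)
  ultimately obtain z where z: "z \<in> S" "\<And>y. y \<in> S \<Longrightarrow> fst y \<le> fst z"
    using continuous_attains_sup[of S fst] continuous_on_fst[OF continuous_on_id] by blast
  obtain r x where rx: "z = (r, x)" by fastforce
  have x: "r \<ge> 0" "\<And>i. x i \<in> {0..1}" "(\<Sum>i<n. x i) = 1" "\<And>i. i < n \<Longrightarrow> r * x i \<le> trunc_app n M x i"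
    using z(1) by (auto simp: S_def rx trunc_app_def)
  have "\<exists>j<n. x j > 0"
  proof (rule ccontr)
    assume "\<not> ?thesis"
    then have "x j = 0" if "j < n" for j using x(2)[of j] that by force
    then show False using x(3) by simp
  qed
  then obtain j0 where j0: "j0 < n" "x j0 > 0" by blast
  define y where "y = (\<lambda>i. trunc_app n M x i - r * x i)"
  define u where "u = (trunc_app n M ^^ n) x"
  have u: "u i > 0" if "i < n" for i
    unfolding u_def using trunc_app_pow_pos_all[where x = x, OF M _ j0] x(2) that by auto
  have eig: "trunc_app n M x i = r * x i" if i: "i < n" for i
  proof (rule ccontr)
    assume "trunc_app n M x i \<noteq> r * x i"
    then have yi: "y i > 0" using x(4)[OF i] by (simp add: y_def)
    have y0: "y k \<ge> 0" if "k < n" for k using x(4)[OF that] by (simp add: y_def)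
    have yk: "(trunc_app n M ^^ k) y l = trunc_app n M ((trunc_app n M ^^ k) x) l - r * (trunc_app n M ^^ k) x l"
      if "l < n" for k l
      using that
    proof (induction k arbitrary: l)
      case (Suc k)
      have "(trunc_app n M ^^ Suc k) y l =
          trunc_app n M (\<lambda>l. 1 * trunc_app n M ((trunc_app n M ^^ k) x) l + (- r) * (trunc_app n M ^^ k) x l) l"
        using Suc by (auto intro!: trunc_app_cong)
      then show ?case by (subst (asm) trunc_app_combine) simp
    qed (simp add: y_def)
    have pos: "trunc_app n M u l - r * u l > 0" if "l < n" for l
      using trunc_app_pow_pos_all[where x = y, OF M y0 i yi that] yk[OF that, of n] by (simp add: u_def)
    \<comment> \<open>The largest increment of \<open>r\<close> that the strict inequality for \<open>u\<close> tolerates.\<close>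
  define e where "e = Min ((\<lambda>l. (trunc_app n M u l - r * u l) / u l) ` {..<n})"
    have e: "e > 0" unfolding e_def using n pos u by (subst Min_gr_iff) auto
    have e_le: "(r + e) * u l \<le> trunc_app n M u l" if "l < n" for l
    proof -
      have "e \<le> (trunc_app n M u l - r * u l) / u l" unfolding e_def using that by (intro Min_le) auto
      then show ?thesis using u[OF that] by (simp add: field_simps)
    qed
    define s where "s = (\<Sum>l<n. u l)"
    have s: "s > 0" unfolding s_def using n u by (intro sum_pos) auto
    have us: "u l \<le> s" if "l < n" for l
      unfolding s_def using that u by (intro member_le_sum) (auto intro: less_imp_le)
    define w where "w = (\<lambda>l. if l < n then u l / s else 0)"
    have w: "w l \<in> {0..1}" for l using u[of l] us[of l] s by (auto simp: w_def)
    have w1: "(\<Sum>l<n. w l) = 1"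
      using s by (simp add: w_def flip: sum_divide_distrib s_def)
    have w2: "(r + e) * w l \<le> (\<Sum>j<n. M l j * w j)" if "l < n" for l
    proof -
      have "(\<Sum>j<n. M l j * w j) = trunc_app n M u l / s"
        by (simp add: w_def trunc_app_def sum_divide_distrib)
      moreover have "(r + e) * w l = (r + e) * u l / s" using that by (simp add: w_def)
      ultimately show ?thesis using e_le[OF that] s by (simp add: divide_right_mono)
    qed
    have "(r + e, w) \<in> S"
      unfolding S_def using bound[OF w w1 w2] w w1 w2 x(1) e by auto
    then show False using z(2) e by (fastforce simp: rx)
  qed
  have pu: "u i = r ^ n * x i" if "i < n" for i
    unfolding u_def using trunc_app_pow_eigen[OF eig that] by simp
  have xpos: "x i > 0" if "i < n" for i
    using u[OF that] pu[OF that] x(1) x(2)[of i] by (auto simp: zero_less_mult_iff)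
  have "r > 0"
  proof -
    have "0 < trunc_app n M x 0"
      using trunc_app_pow_pos[where x = x and j = 0 and i = 0 and k = 1, OF M] x(2) xpos n by auto
    then show ?thesis using eig[OF n] x(1) by (auto simp: zero_less_mult_iff)
  qed
  then show ?thesis using xpos eig by blast
qed

text \<open>
  Subtract from \<open>x\<close> the largest multiple of \<open>v\<close> that keeps it nonnegative. The difference is a
  nonnegative eigenvector with a zero component, whereas a high power of \<open>M\<close> makes every nonzero
  nonnegative vector positive.
\<close>

lemma perron_simple:
  assumes M: "connected_kernel n M" and r: "r > 0" and v: "\<And>i. i < n \<Longrightarrow> v i > 0"
    and Mv: "\<And>i. i < n \<Longrightarrow> trunc_app n M v i = r * v i"
    and Mx: "\<And>i. i < n \<Longrightarrow> trunc_app n M x i = r * x i"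
  shows "\<exists>t. \<forall>i<n. x i = t * v i"
proof (cases "n = 0")
  case False
  define t where "t = Min ((\<lambda>i. x i / v i) ` {..<n})"
  have "t \<in> (\<lambda>i. x i / v i) ` {..<n}" unfolding t_def using False by (intro Min_in) auto
  then obtain i0 where i0: "i0 < n" "t = x i0 / v i0" by auto
  define y where "y = (\<lambda>i. 1 * x i + (- t) * v i)"
  have y: "y i \<ge> 0" if "i < n" for i
  proof -
    have "t \<le> x i / v i" unfolding t_def using that by (intro Min_le) auto
    then show ?thesis using v[OF that] by (simp add: y_def field_simps)
  qed
  have My: "trunc_app n M y i = r * y i" if "i < n" for i
    unfolding y_def by (subst trunc_app_combine) (simp add: Mx Mv that algebra_simps)
  have y0: "y i0 = 0" using v[OF i0(1)] by (simp add: y_def i0(2))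
  have "y i = 0" if i: "i < n" for i
  proof (rule ccontr)
    assume "y i \<noteq> 0"
    then have "y i > 0" using y[OF i] by simp
    from trunc_app_pow_pos_all[where x = y, OF M y i this i0(1)] show False
      using trunc_app_pow_eigen[OF My i0(1), of n] y0 by simp
  qed
  then show ?thesis by (auto simp: y_def intro!: exI[of _ t])
qed auto

section \<open>Deflation of bidiagonal products\<close>

definition pos_lower :: "nat \<Rightarrow> semi_mat \<Rightarrow> bool" where
  "pos_lower n F \<longleftrightarrow> (\<forall>i<n. F i i > 0) \<and> (\<forall>i. Suc i < n \<longrightarrow> F (Suc i) i > 0) \<and>
     (\<forall>i<n. \<forall>j<n. i \<noteq> j \<and> i \<noteq> Suc j \<longrightarrow> F i j = 0)"

text \<open>
  The partial sums with index below \<open>n\<close> are linear coordinates on the hyperplane \<open>w \<cdot> x = 0\<close> of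
  vectors of length \<open>n + 1\<close>, if all components of \<open>w\<close> are nonzero.
\<close>

definition psum :: "(nat \<Rightarrow> real) \<Rightarrow> (nat \<Rightarrow> real) \<Rightarrow> nat \<Rightarrow> real" where
  "psum w x i = (\<Sum>j\<le>i. w j * x j)"

lemma psum_0: "psum w x 0 = w 0 * x 0"
  and psum_Suc: "psum w x (Suc i) = psum w x i + w (Suc i) * x (Suc i)"
  by (auto simp: psum_def)

lemma psum_last: "psum w x n = (\<Sum>j<Suc n. w j * x j)"
  by (simp add: psum_def lessThan_Suc_atMost)

lemma transposed_transposed [simp]: "transposed (transposed M) = M"
  by (simp add: transposed_def fun_eq_iff)

lemma sum_one_term:
  fixes f :: "nat \<Rightarrow> real"
  assumes "a < n" "\<And>j. j < n \<Longrightarrow> j \<noteq> a \<Longrightarrow> f j = 0"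
  shows "(\<Sum>j<n. f j) = f a"
  using sum.mono_neutral_right[of "{..<n}" "{a}" f] assms by auto

lemma sum_two_terms:
  fixes f :: "nat \<Rightarrow> real"
  assumes "a < n" "b < n" "a \<noteq> b" "\<And>j. j < n \<Longrightarrow> j \<noteq> a \<Longrightarrow> j \<noteq> b \<Longrightarrow> f j = 0"
  shows "(\<Sum>j<n. f j) = f a + f b"
  using sum.mono_neutral_right[of "{..<n}" "{a, b}" f] assms by auto

lemma trunc_app_lower_0: "pos_lower n F \<Longrightarrow> 0 < n \<Longrightarrow> trunc_app n F x 0 = F 0 0 * x 0"
  unfolding trunc_app_def by (rule sum_one_term) (auto simp: pos_lower_def)

lemma trunc_app_lower_Suc:
  "pos_lower n F \<Longrightarrow> Suc i < n \<Longrightarrow>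
     trunc_app n F x (Suc i) = F (Suc i) (Suc i) * x (Suc i) + F (Suc i) i * x i"
  unfolding trunc_app_def by (rule sum_two_terms) (auto simp: pos_lower_def)

lemma trunc_app_transp_lower:
  "pos_lower n F \<Longrightarrow> Suc i < n \<Longrightarrow> trunc_app n (transposed F) x i = F i i * x i + F (Suc i) i * x (Suc i)"
  unfolding trunc_app_def transposed_def
  by (rule sum_two_terms[where a = i and b = "Suc i", THEN trans]) (auto simp: pos_lower_def)

lemma trunc_app_transp_lower_last: "pos_lower (Suc n) F \<Longrightarrow> trunc_app (Suc n) (transposed F) x n = F n n * x n"
  unfolding trunc_app_def transposed_def by (rule sum_one_term[THEN trans]) (auto simp: pos_lower_def)

text \<open>
  Summation by parts: \<open>F\<close> changes the partial sum with index \<open>i\<close> only by what it moves across the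
  boundary between \<open>i\<close> and \<open>i + 1\<close>, namely \<open>w (i+1) * F (i+1) i * x i\<close>, and \<open>v i * x i\<close> is a
  difference of two consecutive partial sums. Thus the new partial sum is a convex combination of the
  old ones with indices \<open>i\<close> and \<open>i - 1\<close>.
\<close>

lemma deflate_lower:
  assumes F: "pos_lower (Suc n) F" and w: "\<And>i. i < Suc n \<Longrightarrow> w i > 0"
  defines "v \<equiv> trunc_app (Suc n) (transposed F) w"
  shows "\<exists>G. pos_lower n G \<and>
     (\<forall>x. \<forall>i<n. psum w (trunc_app (Suc n) F x) i = trunc_app n G (psum v x) i)"
proof -
  define a where "a = (\<lambda>i. F (Suc i) i * w (Suc i) / v i)"
  define G :: semi_mat where "G i j = (if i = j then F i i * w i / v i
      else if i = Suc j then a i else 0)" for i j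
  have v: "v i = F i i * w i + F (Suc i) i * w (Suc i)" if "i < n" for i
    unfolding v_def using trunc_app_transp_lower[OF F] that by simp
  have Fpos: "F i i > 0" "i < n \<Longrightarrow> F (Suc i) i > 0" if "i < Suc n" for i
    using F that by (auto simp: pos_lower_def)
  have vpos: "v i > 0" if "i < n" for i
    unfolding v[OF that] using Fpos w that by (intro add_pos_pos mult_pos_pos) auto
  have G: "pos_lower n G"
    using Fpos w vpos by (auto simp: pos_lower_def G_def a_def)
  have diag: "G i i = 1 - a i" if "i < n" for i
    using v[OF that] vpos[OF that] by (simp add: G_def a_def field_simps)
  have s: "psum w (trunc_app (Suc n) F x) i = psum v x i - a i * (v i * x i)" if "i < n" for x i
    using that
  proof (induction i)
    case 0
    then show ?case using vpos[of 0] v[of 0]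
      by (simp add: psum_0 trunc_app_lower_0[OF F] a_def field_simps)
  next
    case (Suc i)
    have "a i * (v i * x i) = F (Suc i) i * w (Suc i) * x i"
      "a (Suc i) * (v (Suc i) * x (Suc i)) = F (Suc (Suc i)) (Suc i) * w (Suc (Suc i)) * x (Suc i)"
      using vpos[of i] vpos[of "Suc i"] Suc.prems by (simp_all add: a_def)
    moreover have "psum w (trunc_app (Suc n) F x) i = psum v x i - a i * (v i * x i)"
      using Suc by simp
    ultimately show ?case using Suc.prems
      by (simp only: psum_Suc trunc_app_lower_Suc[OF F] v[OF Suc.prems] Suc_mono) (simp add: algebra_simps)
  qed
  have "psum w (trunc_app (Suc n) F x) i = trunc_app n G (psum v x) i" if i: "i < n" for x i
  proof (cases i)
    case 0
    then have "trunc_app n G (psum v x) i = (1 - a i) * psum v x i"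
      using i trunc_app_lower_0[OF G, of "psum v x"] diag[OF i] by simp
    then show ?thesis unfolding s[OF i] by (simp add: 0 psum_0 algebra_simps)
  next
    case (Suc k)
    have "G i k = a i" by (simp add: G_def Suc)
    then have "trunc_app n G (psum v x) i = (1 - a i) * psum v x i + a i * psum v x k"
      using i trunc_app_lower_Suc[OF G, of k "psum v x"] diag[OF i] by (simp add: Suc)
    then show ?thesis unfolding s[OF i] by (simp add: Suc psum_Suc algebra_simps)
  qed
  then show ?thesis using G by blast
qed

text \<open>
  An upper factor moves mass towards smaller indices, so the new partial sum mixes the old ones with indices \<open>i\<close> and
  \<open>i + 1\<close>. For \<open>i = n - 1\<close> the second one is the total sum, which vanishes on the hyperplane.
\<close>

lemma deflate_upper:
  assumes F: "pos_lower (Suc n) (transposed F)" and w: "\<And>i. i < Suc n \<Longrightarrow> w i > 0"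
  defines "v \<equiv> trunc_app (Suc n) (transposed F) w"
  shows "\<exists>G. pos_lower n (transposed G) \<and> (\<forall>x. (\<Sum>j<Suc n. v j * x j) = 0 \<longrightarrow>
     (\<forall>i<n. psum w (trunc_app (Suc n) F x) i = trunc_app n G (psum v x) i))"
proof -
  define a where "a = (\<lambda>i. F i (Suc i) * w i / v (Suc i))"
  define G :: semi_mat where "G i j = (if i = j then F (Suc i) (Suc i) * w (Suc i) / v (Suc i)
      else if j = Suc i then a i else 0)" for i j
  have v0: "v 0 = F 0 0 * w 0"
    unfolding v_def by (subst trunc_app_lower_0[OF F]) (auto simp: transposed_def)
  have v: "v (Suc i) = F (Suc i) (Suc i) * w (Suc i) + F i (Suc i) * w i" if "i < n" for i
    unfolding v_def using trunc_app_lower_Suc[OF F, of i w] that by (simp add: transposed_def)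
  have Fpos: "F i i > 0" "i < n \<Longrightarrow> F i (Suc i) > 0" if "i < Suc n" for i
    using F that by (auto simp: pos_lower_def transposed_def)
  have vpos: "v (Suc i) > 0" if "i < n" for i
    unfolding v[OF that] using Fpos w that by (intro add_pos_pos mult_pos_pos) auto
  have G: "pos_lower n (transposed G)"
    using Fpos w vpos by (auto simp: pos_lower_def G_def a_def transposed_def)
  have diag: "G i i = 1 - a i" if "i < n" for i
    using v[OF that] vpos[OF that] by (simp add: G_def a_def field_simps)
  have Fx: "trunc_app (Suc n) F x i = F i i * x i + F i (Suc i) * x (Suc i)" if "i < n" for x i
    using trunc_app_transp_lower[OF F, of i x] that by (simp add: transposed_def)
  have s: "psum w (trunc_app (Suc n) F x) i = psum v x i + a i * (v (Suc i) * x (Suc i))"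
    if "i < n" for x i
    using that
  proof (induction i)
    case 0
    then show ?case using vpos[of 0] v0
      by (simp add: psum_0 Fx a_def field_simps)
  next
    case (Suc i)
    have "a i * (v (Suc i) * x (Suc i)) = F i (Suc i) * w i * x (Suc i)"
      "a (Suc i) * (v (Suc (Suc i)) * x (Suc (Suc i))) =
         F (Suc i) (Suc (Suc i)) * w (Suc i) * x (Suc (Suc i))"
      using vpos[of i] vpos[of "Suc i"] Suc.prems by (simp_all add: a_def)
    moreover have "psum w (trunc_app (Suc n) F x) i = psum v x i + a i * (v (Suc i) * x (Suc i))"
      using Suc by simp
    moreover have "i < n" using Suc.prems by simp
    ultimately show ?case
      by (simp only: psum_Suc Fx[OF Suc.prems] v[of i]) (simp add: algebra_simps)
  qed
  have "psum w (trunc_app (Suc n) F x) i = trunc_app n G (psum v x) i"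
    if i: "i < n" and x: "(\<Sum>j<Suc n. v j * x j) = 0" for x i
  proof (cases "Suc i = n")
    case True
    have "psum v x (Suc i) = 0" using x by (simp add: psum_last True del: sum.lessThan_Suc)
    then have "v (Suc i) * x (Suc i) = - psum v x i" by (simp add: psum_Suc)
    moreover have "trunc_app n G (psum v x) i = G i i * psum v x i"
      using trunc_app_transp_lower_last[of i "transposed G" "psum v x"] G True by (simp add: transposed_def)
    ultimately show ?thesis unfolding s[OF i] diag[OF i] by (simp add: algebra_simps)
  next
    case False
    then have "Suc i < n" using i by simp
    moreover have "G i (Suc i) = a i" by (simp add: G_def)
    ultimately have "trunc_app n G (psum v x) i = (1 - a i) * psum v x i + a i * psum v x (Suc i)"
      using i trunc_app_transp_lower[OF G, of i "psum v x"] diag[OF i] by (simp add: transposed_def)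
    then show ?thesis unfolding s[OF i] by (simp add: psum_Suc algebra_simps)
  qed
  then show ?thesis using G by blast
qed

text \<open>
  The flags \<open>l\<close> and \<open>u\<close> tell whether a lower and an upper bidiagonal factor occurs, which
  makes the subdiagonal, respectively the superdiagonal, of the product positive. Deflation preserves
  them, so that the deflated product is again connected.
\<close>

inductive bidiag_prod :: "nat \<Rightarrow> bool \<Rightarrow> bool \<Rightarrow> semi_mat \<Rightarrow> bool" for n where
  lower: "pos_lower n F \<Longrightarrow> bidiag_prod n True False F"
| upper: "pos_lower n (transposed F) \<Longrightarrow> bidiag_prod n False True F"
| mult: "bidiag_prod n l u F \<Longrightarrow> bidiag_prod n l' u' G \<Longrightarrow>
     bidiag_prod n (l \<or> l') (u \<or> u') (trunc_mult n F G)"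
| cong: "bidiag_prod n l u F \<Longrightarrow> (\<And>i j. i < n \<Longrightarrow> j < n \<Longrightarrow> F i j = G i j) \<Longrightarrow> bidiag_prod n l u G"

lemma transposed_trunc_mult: "transposed (trunc_mult n F G) = trunc_mult n (transposed G) (transposed F)"
  by (simp add: transposed_def trunc_mult_def fun_eq_iff mult.commute)

lemma bidiag_prod_transp: "bidiag_prod n l u M \<Longrightarrow> bidiag_prod n u l (transposed M)"
proof (induction rule: bidiag_prod.induct)
  case (mult l u F l' u' G)
  have "bidiag_prod n (u' \<or> u) (l' \<or> l) (trunc_mult n (transposed G) (transposed F))"
    using mult.IH by (intro bidiag_prod.mult)
  then show ?case by (simp add: transposed_trunc_mult disj_commute)
next
  case (cong l u F G)
  show ?case by (rule bidiag_prod.cong[OF cong.IH]) (simp add: transposed_def cong.hyps)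
next
  case (lower F)
  then show ?case by (intro bidiag_prod.upper) simp
next
  case (upper F)
  then show ?case by (intro bidiag_prod.lower)
qed

lemma trunc_mult_ge:
  assumes "\<And>i j. i < n \<Longrightarrow> j < n \<Longrightarrow> F i j \<ge> 0" "\<And>i j. i < n \<Longrightarrow> j < n \<Longrightarrow> G i j \<ge> 0"
    "i < n" "j < n" "k < n"
  shows "trunc_mult n F G i j \<ge> F i k * G k j"
  unfolding trunc_mult_def using assms by (intro member_le_sum) auto

lemma bidiag_prod_pos:
  "bidiag_prod n l u M \<Longrightarrow> (\<forall>i<n. \<forall>j<n. M i j \<ge> 0) \<and> (\<forall>i<n. M i i > 0) \<and>
     (l \<longrightarrow> (\<forall>i. Suc i < n \<longrightarrow> M (Suc i) i > 0)) \<and> (u \<longrightarrow> (\<forall>i. Suc i < n \<longrightarrow> M i (Suc i) > 0))"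
proof (induction rule: bidiag_prod.induct)
  case (lower F)
  have "F i j \<ge> 0" if "i < n" "j < n" for i j
    using lower that unfolding pos_lower_def by (metis less_eq_real_def)
  then show ?case using lower by (simp add: pos_lower_def)
next
  case (upper F)
  have "F i j \<ge> 0" if "i < n" "j < n" for i j
    using upper that unfolding pos_lower_def transposed_def by (metis less_eq_real_def)
  then show ?case using upper by (simp add: pos_lower_def transposed_def)
next
  case (mult l u F l' u' G)
  have nn: "\<And>i j. i < n \<Longrightarrow> j < n \<Longrightarrow> F i j \<ge> 0" "\<And>i j. i < n \<Longrightarrow> j < n \<Longrightarrow> G i j \<ge> 0"
    and d: "\<And>i. i < n \<Longrightarrow> F i i > 0" "\<And>i. i < n \<Longrightarrow> G i i > 0" using mult by auto
  have pos: "trunc_mult n F G i j > 0" if "i < n" "j < n" "F i j > 0 \<or> G i j > 0" for i j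
    using that(3)
  proof
    assume "F i j > 0"
    then have "0 < F i j * G j j" using d(2)[OF that(2)] by simp
    also have "\<dots> \<le> trunc_mult n F G i j" by (intro trunc_mult_ge nn that)
    finally show ?thesis .
  next
    assume "G i j > 0"
    then have "0 < F i i * G i j" using d(1)[OF that(1)] by simp
    also have "\<dots> \<le> trunc_mult n F G i j" by (intro trunc_mult_ge nn that)
    finally show ?thesis .
  qed
  have "trunc_mult n F G i j \<ge> 0" if "i < n" "j < n" for i j
    unfolding trunc_mult_def using nn that by (intro sum_nonneg mult_nonneg_nonneg) auto
  moreover have "trunc_mult n F G i i > 0" if "i < n" for i using pos[OF that that] d(1)[OF that] by blast
  moreover have "trunc_mult n F G (Suc i) i > 0" if "l \<or> l'" "Suc i < n" for i
    using that mult.IH by (intro pos) auto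
  moreover have "trunc_mult n F G i (Suc i) > 0" if "u \<or> u'" "Suc i < n" for i
    using that mult.IH by (intro pos) auto
  ultimately show ?case by blast
next
  case (cong l u F G)
  have "G i j = F i j" if "i < n" "j < n" for i j using cong.hyps(2)[OF that] by simp
  then show ?case using cong.IH by simp
qed

lemma bidiag_prod_connected: "bidiag_prod n True True M \<Longrightarrow> connected_kernel n M"
  using bidiag_prod_pos[of n True True M] by (simp add: connected_kernel_def)

text \<open>
  Propagating the weight vector through the factors keeps it positive, and each factor maps the
  hyperplane of its output weight into that of its input weight, so the factors can be deflated one
  after the other.
\<close>

lemma bidiag_prod_deflate:
  assumes "bidiag_prod (Suc n) l u M" and "\<And>i. i < Suc n \<Longrightarrow> w i > 0"
  shows "\<exists>G. bidiag_prod n l u G \<and> (\<forall>x. (\<Sum>j<Suc n. trunc_app (Suc n) (transposed M) w j * x j) = 0 \<longrightarrow>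
     (\<forall>i<n. psum w (trunc_app (Suc n) M x) i = trunc_app n G (psum (trunc_app (Suc n) (transposed M) w) x) i))"
  using assms
proof (induction arbitrary: w rule: bidiag_prod.induct)
  case (lower F)
  then show ?case using deflate_lower[of n F w] by (blast intro: bidiag_prod.lower)
next
  case (upper F)
  then show ?case using deflate_upper[of n F w] by (blast intro: bidiag_prod.upper)
next
  case (mult l u F l' u' G)
  define w' where "w' = trunc_app (Suc n) (transposed F) w"
  obtain F' where F': "bidiag_prod n l u F'" "\<And>x i. (\<Sum>j<Suc n. w' j * x j) = 0 \<Longrightarrow> i < n \<Longrightarrow>
      psum w (trunc_app (Suc n) F x) i = trunc_app n F' (psum w' x) i"
    using mult.IH(1)[where w = w, OF mult.prems] unfolding w'_def by blast
  have w': "w' i > 0" if i: "i < Suc n" for i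
  proof -
    have "transposed F i j \<ge> 0" "transposed F i i > 0" if "j < Suc n" for j
      using bidiag_prod_pos[OF mult.hyps(1)] that i by (auto simp: transposed_def)
    then show ?thesis unfolding w'_def trunc_app_def using mult.prems i
      by (intro sum_pos2[where i = i]) (auto intro!: mult_nonneg_nonneg mult_pos_pos intro: less_imp_le[OF mult.prems])
  qed
  define w'' where "w'' = trunc_app (Suc n) (transposed G) w'"
  obtain G' where G': "bidiag_prod n l' u' G'" "\<And>x i. (\<Sum>j<Suc n. w'' j * x j) = 0 \<Longrightarrow> i < n \<Longrightarrow>
      psum w' (trunc_app (Suc n) G x) i = trunc_app n G' (psum w'' x) i"
    using mult.IH(2)[where w = w', OF w'] unfolding w''_def by blast
  have eq: "trunc_app (Suc n) (transposed (trunc_mult (Suc n) F G)) w = w''"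
    unfolding w''_def w'_def transposed_trunc_mult by (rule ext) (rule trunc_app_mult)
  have "psum w (trunc_app (Suc n) (trunc_mult (Suc n) F G) x) i = trunc_app n (trunc_mult n F' G') (psum w'' x) i"
    if x: "(\<Sum>j<Suc n. w'' j * x j) = 0" and i: "i < n" for x i
  proof -
    have "(\<Sum>j<Suc n. w' j * trunc_app (Suc n) G x j) = 0"
      unfolding trunc_app_adjoint using x by (simp add: w''_def)
    then have "psum w (trunc_app (Suc n) F (trunc_app (Suc n) G x)) i = trunc_app n F' (psum w' (trunc_app (Suc n) G x)) i"
      using F'(2) i by blast
    also have "\<dots> = trunc_app n F' (trunc_app n G' (psum w'' x)) i"
      by (intro trunc_app_cong refl G'(2)[OF x])
    finally show ?thesis by (simp add: trunc_app_mult[abs_def])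
  qed
  then show ?case unfolding eq using bidiag_prod.mult[OF F'(1) G'(1)] by blast
next
  case (cong l u F G)
  have 1: "trunc_app (Suc n) (transposed G) w j = trunc_app (Suc n) (transposed F) w j" if "j < Suc n" for w j
    using that cong.hyps by (intro trunc_app_cong) (auto simp: transposed_def)
  have 2: "trunc_app (Suc n) G x j = trunc_app (Suc n) F x j" if "j < Suc n" for x j
    using that cong.hyps by (intro trunc_app_cong) auto
  have 3: "psum (trunc_app (Suc n) (transposed G) w) x i = psum (trunc_app (Suc n) (transposed F) w) x i"
    "psum w (trunc_app (Suc n) G x) i = psum w (trunc_app (Suc n) F x) i" if "i < n" for x i
    using that unfolding psum_def by (auto simp: 1 2)
  have 4: "trunc_app n H (psum (trunc_app (Suc n) (transposed G) w) x) i = trunc_app n H (psum (trunc_app (Suc n) (transposed F) w) x) i"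
    for H x i by (intro trunc_app_cong refl 3)
  have 5: "(\<Sum>j<Suc n. trunc_app (Suc n) (transposed G) w j * x j) = (\<Sum>j<Suc n. trunc_app (Suc n) (transposed F) w j * x j)"
    for x by (rule sum.cong) (auto simp: 1)
  obtain H where "bidiag_prod n l u H" "\<And>x i. (\<Sum>j<Suc n. trunc_app (Suc n) (transposed F) w j * x j) = 0 \<Longrightarrow>
      i < n \<Longrightarrow> psum w (trunc_app (Suc n) F x) i = trunc_app n H (psum (trunc_app (Suc n) (transposed F) w) x) i"
    using cong.IH[where w = w, OF cong.prems] by blast
  then show ?case unfolding 4 5 using 3(2) by metis
qed

definition eigenvec :: "nat \<Rightarrow> semi_mat \<Rightarrow> real \<Rightarrow> (nat \<Rightarrow> real) \<Rightarrow> bool" where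
  "eigenvec n M \<mu> x \<longleftrightarrow> (\<exists>i<n. x i \<noteq> 0) \<and> (\<forall>i<n. trunc_app n M x i = \<mu> * x i)"

lemma psum_eq_0_imp:
  assumes w: "\<And>i. i < Suc n \<Longrightarrow> w i > 0" and s: "\<And>i. i < n \<Longrightarrow> psum w x i = 0"
    and h: "psum w x n = 0" and i: "i < Suc n"
  shows "x i = 0"
proof -
  have p: "psum w x k = 0" if "k \<le> n" for k using that s h by (cases "k = n") auto
  show ?thesis using p[of i] p[of "i - 1"] i w[OF i] by (cases i) (auto simp: psum_0 psum_Suc)
qed

lemma psum_surj:
  assumes w: "\<And>i. i < Suc n \<Longrightarrow> w i > 0"
  shows "\<exists>x. (\<forall>i\<le>n. psum w x i = s i)"
proof -
  define x where "x = (\<lambda>i. case i of 0 \<Rightarrow> s 0 / w 0 | Suc k \<Rightarrow> (s (Suc k) - s k) / w (Suc k))"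
  have "psum w x i = s i" if "i \<le> n" for i
    using that
  proof (induction i)
    case 0
    then show ?case using w[of 0] by (simp add: psum_0 x_def)
  next
    case (Suc i)
    then show ?case using w[of "Suc i"] by (simp add: psum_Suc x_def)
  qed
  then show ?thesis by blast
qed

text \<open>
  With a left Perron vector \<open>w\<close> for \<open>r\<close>, an eigenvector for another eigenvalue lies on the hyperplane
  \<open>w \<cdot> x = 0\<close>, where \<open>M\<close> is conjugate to \<open>r\<close> times the deflated product. Its last component is
  \<open>- psum w x (n - 1) / w n\<close>, with \<open>n + 1\<close> the size of \<open>M\<close>, and the last component of the
  coordinate vector is nonzero by induction.
\<close>

lemma bidiag_prod_spectrum:
  assumes "bidiag_prod n True True M"
  shows "(\<exists>E. finite E \<and> card E = n \<and> (\<forall>\<mu>\<in>E. \<exists>x. eigenvec n M \<mu> x)) \<and>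
     (\<forall>\<mu> x. eigenvec n M \<mu> x \<longrightarrow> x (n - 1) \<noteq> 0)"
  using assms
proof (induction n arbitrary: M)
  case 0
  then show ?case by (auto simp: eigenvec_def)
next
  case (Suc n)
  let ?n = "Suc n"
  have M: "connected_kernel ?n M" "connected_kernel ?n (transposed M)"
    using Suc.prems bidiag_prod_transp bidiag_prod_connected by blast+
  obtain r v where r: "r > 0" and v: "\<And>i. i < ?n \<Longrightarrow> v i > 0"
    "\<And>i. i < ?n \<Longrightarrow> trunc_app ?n M v i = r * v i"
    using perron_vector[OF M(1)] by blast
  obtain r' w where r': "r' > 0" and w: "\<And>i. i < ?n \<Longrightarrow> w i > 0"
    "\<And>i. i < ?n \<Longrightarrow> trunc_app ?n (transposed M) w i = r' * w i"
    using perron_vector[OF M(2)] by blast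
  have left: "(\<Sum>i<?n. w i * trunc_app ?n M x i) = r' * (\<Sum>i<?n. w i * x i)" for x
    unfolding trunc_app_adjoint using w(2)
    by (simp add: sum_distrib_left mult.assoc del: sum.lessThan_Suc)
  have "(\<Sum>i<?n. w i * trunc_app ?n M v i) = r * (\<Sum>i<?n. w i * v i)"
    using v(2) by (simp add: sum_distrib_left mult.left_commute del: sum.lessThan_Suc)
  moreover have wv: "(\<Sum>i<?n. w i * v i) > 0" using v w by (intro sum_pos) auto
  ultimately have "r' = r" using left[of v] by simp
  note left = left[unfolded this] and w = w[unfolded this]
  obtain G where G: "bidiag_prod n True True G" and
    G_eq: "\<And>x i. (\<Sum>j<?n. trunc_app ?n (transposed M) w j * x j) = 0 \<Longrightarrow> i < n \<Longrightarrow>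
      psum w (trunc_app ?n M x) i = trunc_app n G (psum (trunc_app ?n (transposed M) w) x) i"
    using bidiag_prod_deflate[where w = w, OF Suc.prems w(1)] by blast
  have G_psum: "psum w (trunc_app ?n M x) i = r * trunc_app n G (psum w x) i"
    if x: "psum w x n = 0" and i: "i < n" for x i
  proof -
    have 1: "psum (trunc_app ?n (transposed M) w) x j = r * psum w x j + 0 * psum w x j" if "j \<le> n" for j
      using that w(2) by (simp add: psum_def sum_distrib_left mult.assoc)
    have "(\<Sum>j<?n. trunc_app ?n (transposed M) w j * x j) = 0"
      using 1[of n] x by (simp add: psum_last del: sum.lessThan_Suc)
    then have "psum w (trunc_app ?n M x) i = trunc_app n G (psum (trunc_app ?n (transposed M) w) x) i"
      using G_eq i by blast
    also have "\<dots> = trunc_app n G (\<lambda>j. r * psum w x j + 0 * psum w x j) i"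
      using 1 by (intro trunc_app_cong) auto
    finally show ?thesis by (subst (asm) trunc_app_combine) simp
  qed
  obtain E where E: "finite E" "card E = n" "\<And>\<mu>. \<mu> \<in> E \<Longrightarrow> \<exists>x. eigenvec n G \<mu> x"
    and last: "\<And>\<mu> x. eigenvec n G \<mu> x \<Longrightarrow> x (n - 1) \<noteq> 0"
    using Suc.IH[OF G] by blast
  have inherit: "\<exists>x. eigenvec ?n M (r * \<kappa>) x \<and> psum w x n = 0" if \<kappa>: "\<kappa> \<in> E" for \<kappa>
  proof -
    obtain s where s: "eigenvec n G \<kappa> s" using E(3)[OF \<kappa>] by blast
    obtain x where x: "\<And>i. i \<le> n \<Longrightarrow> psum w x i = (if i < n then s i else 0)"
      using psum_surj[where n = n and w = w and s = "\<lambda>i. if i < n then s i else 0", OF w(1)] by auto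
    have x0: "psum w x n = 0" using x[of n] by simp
    \<comment> \<open>The residual \<open>y\<close> lies on the hyperplane, where it is determined by its partial sums.\<close>
  define y where "y = (\<lambda>i. 1 * trunc_app ?n M x i + (- (r * \<kappa>)) * x i)"
    have py: "psum w y i = psum w (trunc_app ?n M x) i - r * \<kappa> * psum w x i" for i
      by (simp add: psum_def y_def sum_subtractf sum_distrib_left algebra_simps)
    have "psum w y i = 0" if "i < n" for i
    proof -
      have "trunc_app n G (psum w x) i = trunc_app n G s i" using x by (intro trunc_app_cong) auto
      then show ?thesis using s that x[of i] G_psum[OF x0 that] by (simp add: py eigenvec_def)
    qed
    moreover have "psum w y n = 0"
      unfolding py using left[of x] x0 by (simp add: psum_last del: sum.lessThan_Suc)
    ultimately have "y i = 0" if "i < ?n" for i using psum_eq_0_imp[where w = w and x = y, OF w(1)] that by blast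
    then have ev: "trunc_app ?n M x i = r * \<kappa> * x i" if "i < ?n" for i using that by (simp add: y_def)
    have "\<exists>i<?n. x i \<noteq> 0"
    proof (rule ccontr)
      assume "\<not> ?thesis"
      then have "psum w x i = 0" if "i \<le> n" for i using that by (simp add: psum_def)
      then have "s i = 0" if "i < n" for i using x[of i] that by simp
      then show False using s by (auto simp: eigenvec_def)
    qed
    then show ?thesis using ev x0 by (auto simp: eigenvec_def)
  qed
  \<comment> \<open>The positive right Perron vector is not on the hyperplane, and by simplicity there is no other for \<open>r\<close>.\<close>
  have new: "r \<noteq> \<mu>" if x: "eigenvec ?n M \<mu> x" "psum w x n = 0" for \<mu> x
  proof
    assume eq: "r = \<mu>"
    have "trunc_app ?n M x i = r * x i" if "i < ?n" for i using x that by (simp add: eigenvec_def eq)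
    then obtain t where t: "\<And>i. i < ?n \<Longrightarrow> x i = t * v i"
      using perron_simple[where v = v and x = x, OF M(1) r v] by blast
    have "psum w x n = t * (\<Sum>i<?n. w i * v i)"
      unfolding psum_last sum_distrib_left by (intro sum.cong) (auto simp: t)
    then have "t = 0" using wv x by simp
    then show False using t x by (auto simp: eigenvec_def)
  qed
  \<comment> \<open>Deflating along the left eigenvector \<open>w\<close> produced weights \<open>r w\<close>, hence the factor \<open>r\<close>.\<close>
  define E' where "E' = insert r ((*) r ` E)"
  have "r \<notin> (*) r ` E" using inherit new by blast
  then have "finite E'" "card E' = ?n"
    unfolding E'_def using E r by (auto simp: card_image inj_on_def)
  moreover have "eigenvec ?n M r v" using v v(1)[of 0] unfolding eigenvec_def
    by (metis less_irrefl zero_less_Suc)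
  then have "\<forall>\<mu>\<in>E'. \<exists>x. eigenvec ?n M \<mu> x" using inherit by (auto simp: E'_def)
  moreover have "x (?n - 1) \<noteq> 0" if x: "eigenvec ?n M \<mu> x" for \<mu> x
  proof (cases "psum w x n = 0")
    case True
    let ?s = "psum w x"
    have ev: "trunc_app n G ?s i = \<mu> / r * ?s i" if "i < n" for i
    proof -
      have "psum w (trunc_app ?n M x) i = \<mu> * ?s i"
        unfolding psum_def sum_distrib_left using x that
        by (intro sum.cong) (auto simp: eigenvec_def)
      then show ?thesis using G_psum[OF True that] r by (simp add: field_simps)
    qed
    have "\<exists>i<n. ?s i \<noteq> 0"
      using psum_eq_0_imp[where n = n and w = w and x = x, OF w(1) _ True] x unfolding eigenvec_def by blast
    then have "eigenvec n G (\<mu> / r) ?s" using ev by (simp add: eigenvec_def)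
    moreover from this have "n > 0" by (auto simp: eigenvec_def)
    ultimately have "?s (n - 1) \<noteq> 0" "n > 0" using last by blast+
    then show ?thesis using True psum_Suc[of w x "n - 1"] by auto
  next
    case False
    have "(\<Sum>i<?n. w i * trunc_app ?n M x i) = \<mu> * (\<Sum>i<?n. w i * x i)"
      unfolding sum_distrib_left using x by (intro sum.cong) (auto simp: eigenvec_def)
    then have "\<mu> = r" using left[of x] False by (simp add: psum_last del: sum.lessThan_Suc)
    then obtain t where t: "\<And>i. i < ?n \<Longrightarrow> x i = t * v i"
      using perron_simple[where v = v and x = x, OF M(1) r v] x by (auto simp: eigenvec_def)
    then have "t \<noteq> 0" using x by (auto simp: eigenvec_def)
    then show ?thesis using t[of n] v(1)[of n] by simp
  qed
  ultimately show ?case by blast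
qed

section \<open>Recursion polynomials and their determinants\<close>

lemma upper_unitriangular_inverse:
  assumes "upper_unitriangular n M"
  shows "mat_inv M \<in> carrier_mat n n" "M * mat_inv M = 1\<^sub>m n" "mat_inv M * M = 1\<^sub>m n"
proof -
  have M: "M \<in> carrier_mat n n" using assms by (simp add: upper_unitriangular_def)
  have "diag_mat M = map (\<lambda>i. 1) [0..<n]"
    using assms by (auto simp: diag_mat_def upper_unitriangular_def)
  then have "prod_list (diag_mat M) = 1" by (simp add: map_replicate_const)
  then have "det M = 1"
    using assms det_upper_triangular[OF _ M] by (simp add: upper_unitriangular_def)
  then have "M \<in> Units (ring_mat TYPE(real) n ())" using det_non_zero_imp_unit[OF M] by simp
  then obtain M' where M': "mat_inverse M = Some M'" using mat_inverse(1)[OF M] by fastforce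
  show "mat_inv M \<in> carrier_mat n n" "M * mat_inv M = 1\<^sub>m n" "mat_inv M * M = 1\<^sub>m n"
    using mat_inverse(2)[OF M M'] by (simp_all add: mat_inv_def M')
qed

text \<open>
  The columns of \<open>\<nu>\<close> hold the initial values of the recursion polynomials, and the vectors \<open>e_nu\<close>
  are the dual basis.
\<close>

lemma e_nu_dual:
  assumes \<nu>: "lower_unitriangular p \<nu>"
  shows "a < p \<Longrightarrow> a' < p \<Longrightarrow> (\<Sum>l<p. \<nu> $$ (l, a') * e_nu p \<nu> (Suc a) l) = (if a = a' then 1 else 0)"
    and "l < p \<Longrightarrow> l' < p \<Longrightarrow> (\<Sum>a<p. \<nu> $$ (l, a) * e_nu p \<nu> (Suc a) l') = (if l = l' then 1 else 0)"
proof -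
  let ?M = "transpose_mat \<nu>"
  have U: "upper_unitriangular p ?M" using \<nu> by (simp add: lower_unitriangular_def)
  have c: "\<nu> \<in> carrier_mat p p" using U by (auto simp: upper_unitriangular_def)
  note I = upper_unitriangular_inverse[OF U]
  show "(\<Sum>l<p. \<nu> $$ (l, a') * e_nu p \<nu> (Suc a) l) = (if a = a' then 1 else 0)"
    if "a < p" "a' < p"
  proof -
    have "(?M * mat_inv ?M) $$ (a', a) = (\<Sum>l<p. \<nu> $$ (l, a') * e_nu p \<nu> (Suc a) l)"
      using c I(1) that by (auto simp: scalar_prod_def e_nu_def atLeast0LessThan)
    then show ?thesis using that by (auto simp: I(2))
  qed
  show "(\<Sum>a<p. \<nu> $$ (l, a) * e_nu p \<nu> (Suc a) l') = (if l = l' then 1 else 0)"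
    if "l < p" "l' < p"
  proof -
    have "(mat_inv ?M * ?M) $$ (l', l) = (\<Sum>a<p. \<nu> $$ (l, a) * e_nu p \<nu> (Suc a) l')"
      using c I(1) that by (auto simp: scalar_prod_def e_nu_def atLeast0LessThan mult.commute)
    then show ?thesis using that by (auto simp: I(3))
  qed
qed

lemma e_xi_eq_e_nu:
  assumes "lower_unitriangular q \<xi>" "b \<in> {1..q}"
  shows "e_xi q \<xi> b = e_nu q \<xi> b"
proof -
  let ?M = "transpose_mat \<xi>"
  have U: "upper_unitriangular q ?M" using assms by (simp add: lower_unitriangular_def)
  have c: "\<xi> \<in> carrier_mat q q" using U by (auto simp: upper_unitriangular_def)
  note I = upper_unitriangular_inverse[OF U]
  have 1: "transpose_mat (mat_inv ?M) * \<xi> = 1\<^sub>m q" "\<xi> * transpose_mat (mat_inv ?M) = 1\<^sub>m q"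
  proof -
    have "transpose_mat (?M * mat_inv ?M) = transpose_mat (mat_inv ?M) * \<xi>"
      "transpose_mat (mat_inv ?M * ?M) = \<xi> * transpose_mat (mat_inv ?M)"
      using I(1) c by (subst transpose_mult[of _ q q _ q]; simp)+
    then show "transpose_mat (mat_inv ?M) * \<xi> = 1\<^sub>m q" "\<xi> * transpose_mat (mat_inv ?M) = 1\<^sub>m q"
      unfolding I(2,3) transpose_one by (simp_all only:)
  qed
  have "\<xi> \<in> Units (ring_mat TYPE(real) q ())"
    using 1 c I(1) by (auto simp: Units_def ring_mat_def)
  then obtain X where X: "mat_inverse \<xi> = Some X" using mat_inverse(1)[OF c] by fastforce
  have X': "\<xi> * X = 1\<^sub>m q" "X * \<xi> = 1\<^sub>m q" "X \<in> carrier_mat q q" using mat_inverse(2)[OF c X] by auto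
  have "X = X * (\<xi> * transpose_mat (mat_inv ?M))" using X' 1 by simp
  also have "\<dots> = transpose_mat (mat_inv ?M)"
    using X' c I(1) by (subst assoc_mult_mat[symmetric, of _ q q _ q _ q]) auto
  finally have "mat_inv \<xi> = transpose_mat (mat_inv ?M)" by (simp add: mat_inv_def X)
  then show ?thesis using assms I(1) by (auto simp: e_xi_def e_nu_def fun_eq_iff)
qed

text \<open>
  For a fixed argument \<open>x\<close> these are all solutions of the recursion, with \<open>p\<close> free coefficients \<open>c\<close>.
\<close>

definition lincomb :: "nat \<Rightarrow> (nat \<Rightarrow> nat \<Rightarrow> real poly) \<Rightarrow> real \<Rightarrow> (nat \<Rightarrow> real) \<Rightarrow> nat \<Rightarrow> real" where
  "lincomb p A x c l = (\<Sum>a<p. c a * poly (A (Suc a) l) x)"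

lemma lincomb_recursion:
  assumes "recursion_A p q T \<nu> A"
  shows "(\<Sum>m = n - q..n + p. T m n * lincomb p A x c m) = x * lincomb p A x c n"
proof -
  have "(\<Sum>m = n - q..n + p. T m n * poly (A (Suc a) m) x) = x * poly (A (Suc a) n) x"
    if "a < p" for a
  proof -
    have "Suc a \<in> {1..p}" using that by simp
    then have "(\<Sum>m = n - q..n + p. Polynomial.smult (T m n) (A (Suc a) m)) = [:0, 1:] * A (Suc a) n"
      using assms unfolding recursion_A_def by blast
    from arg_cong[OF this, of "\<lambda>P. poly P x"] show ?thesis by (simp add: poly_sum)
  qed
  then have "(\<Sum>a<p. c a * (\<Sum>m = n - q..n + p. T m n * poly (A (Suc a) m) x)) =
      (\<Sum>a<p. c a * (x * poly (A (Suc a) n) x))"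
    by (intro sum.cong) auto
  moreover have "(\<Sum>a<p. c a * (\<Sum>m = n - q..n + p. T m n * poly (A (Suc a) m) x)) =
      (\<Sum>m = n - q..n + p. T m n * lincomb p A x c m)"
    unfolding lincomb_def sum_distrib_left by (subst sum.swap) (simp add: mult_ac)
  ultimately show ?thesis by (simp add: lincomb_def sum_distrib_left mult_ac)
qed

lemma lincomb_initial:
  assumes "recursion_A p q T \<nu> A" "l < p"
  shows "lincomb p A x c l = (\<Sum>a<p. c a * \<nu> $$ (l, a))"
proof -
  have "A (Suc a) l = [:\<nu> $$ (l, a):]" if "a < p" for a
    using assms that unfolding recursion_A_def
    by (metis One_nat_def Suc_leI atLeastAtMost_iff diff_Suc_1 le_add1 plus_1_eq_Suc)
  then show ?thesis by (simp add: lincomb_def)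
qed

lemma lincomb_coeff:
  assumes "recursion_A p q T \<nu> A" "lower_unitriangular p \<nu>" "a < p"
  shows "(\<Sum>l<p. lincomb p A x c l * e_nu p \<nu> (Suc a) l) = c a"
proof -
  have "(\<Sum>l<p. lincomb p A x c l * e_nu p \<nu> (Suc a) l) =
      (\<Sum>l<p. \<Sum>a'<p. c a' * (\<nu> $$ (l, a') * e_nu p \<nu> (Suc a) l))"
    by (intro sum.cong) (auto simp: lincomb_initial[OF assms(1)] sum_distrib_right mult.assoc)
  also have "\<dots> = (\<Sum>a'<p. c a' * (if a = a' then 1 else 0))"
    by (subst sum.swap) (simp add: e_nu_dual(1)[OF assms(2,3)] flip: sum_distrib_left)
  also have "\<dots> = c a" using assms(3) by (simp add: if_distrib[of "(*) _"] cong: if_cong)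
  finally show ?thesis .
qed

lemma lincomb_surj:
  assumes "recursion_A p q T \<nu> A" "lower_unitriangular p \<nu>"
  shows "\<exists>c. \<forall>l<p. lincomb p A x c l = t l"
proof (intro exI allI impI)
  fix l assume l: "l < p"
  let ?c = "\<lambda>a. \<Sum>l'<p. t l' * e_nu p \<nu> (Suc a) l'"
  have "lincomb p A x ?c l = (\<Sum>a<p. \<Sum>l'<p. t l' * (\<nu> $$ (l, a) * e_nu p \<nu> (Suc a) l'))"
    by (auto simp: lincomb_initial[OF assms(1) l] sum_distrib_right sum_distrib_left mult_ac)
  also have "\<dots> = (\<Sum>l'<p. t l' * (if l = l' then 1 else 0))"
    by (subst sum.swap) (simp add: e_nu_dual(2)[OF assms(2) l] flip: sum_distrib_left)
  finally show "lincomb p A x ?c l = t l"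
    using l by (simp add: if_distrib[of "(*) _"] cong: if_cong)
qed

text \<open>
  Since \<open>T (n + p) n\<close> does not vanish, the \<open>n\<close>-th equation determines the component \<open>n + p\<close> from
  those before it.
\<close>

lemma recursion_zero:
  fixes y :: "nat \<Rightarrow> real"
  assumes p: "p \<ge> 1" and T: "banded p q T" and y: "\<And>l. l < p \<Longrightarrow> y l = 0"
    and rec: "\<And>n. n \<le> K \<Longrightarrow> (\<Sum>m = n - q..n + p. T m n * y m) = x * y n"
  shows "l \<le> K + p \<Longrightarrow> y l = 0"
proof (induction l rule: less_induct)
  case (less l)
  show ?case
  proof (cases "l < p")
    case False
    define n where "n = l - p"
    have n: "l = n + p" "n \<le> K" using False less.prems by (auto simp: n_def)
    have "{n - q..n + p} = insert l {n - q..<l}" using n by auto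
    then have "(\<Sum>m = n - q..n + p. T m n * y m) = T l n * y l"
      using less.IH less.prems by simp
    then have "T l n * y l = 0" using rec[OF n(2)] less.IH[of n] p n by simp
    then show ?thesis using T n(1) by (auto simp: banded_def)
  qed (simp add: y)
qed

text \<open>
  A vector that vanishes on the \<open>p\<close> positions after \<open>N\<close> does not see that \<open>T\<close> has been cut off; this
  links solutions of the infinite recursion to left eigenvectors of the truncation.
\<close>

lemma band_sum:
  fixes y :: "nat \<Rightarrow> real"
  assumes T: "banded p q T" and y: "\<And>m. N < m \<Longrightarrow> m \<le> n + p \<Longrightarrow> y m = 0"
  shows "trunc_app (Suc N) (transposed T) y n = (\<Sum>m = n - q..n + p. T m n * y m)"
proof -
  have T0: "T m n = 0" if "m < n - q \<or> n + p < m" for m using T that by (auto simp: banded_def)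
  have "trunc_app (Suc N) (transposed T) y n = (\<Sum>m\<in>{..<Suc N} \<union> {n - q..n + p}. T m n * y m)"
    unfolding trunc_app_def transposed_def using y by (intro sum.mono_neutral_left) auto
  also have "\<dots> = (\<Sum>m = n - q..n + p. T m n * y m)"
    using T0 by (intro sum.mono_neutral_right) force+
  finally show ?thesis .
qed

lemma poly_det: "poly (det M) x = det (map_mat (\<lambda>P. poly P x) M)"
proof -
  have "comm_ring_hom (\<lambda>P :: 'a poly. poly P x)" by standard auto
  from comm_ring_hom.hom_det[OF this, of M] show ?thesis by simp
qed

definition first_row_mat :: "nat \<Rightarrow> (nat \<Rightarrow> nat \<Rightarrow> real poly) \<Rightarrow> real \<Rightarrow> nat \<Rightarrow> nat \<Rightarrow> real mat" where
  "first_row_mat p A x n N = mat p p (\<lambda>(i, j). poly (A (Suc j) (if i = 0 then n else N + i)) x)"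

lemma poly_first_row_det: "poly (first_row_det p A n N) x = det (first_row_mat p A x n N)"
  unfolding first_row_det_def first_row_mat_def poly_det
  by (intro arg_cong[where f = det] eq_matI) auto

text \<open>
  The cofactors of the first row in the determinant $Q_{n,N}$; they do not depend on \<open>n\<close>, so that
  $Q_{n,N}$ is a solution of the recursion in \<open>n\<close>.
\<close>

definition signed_minor :: "nat \<Rightarrow> (nat \<Rightarrow> nat \<Rightarrow> real poly) \<Rightarrow> real \<Rightarrow> nat \<Rightarrow> nat \<Rightarrow> real" where
  "signed_minor p A x N a = (-1) ^ a * poly (omit_col_det p A (Suc a) N) x"

lemma first_row_det_lincomb:
  assumes "p \<ge> 1"
  shows "poly (first_row_det p A n N) x = lincomb p A x (signed_minor p A x N) n"
proof -
  have c: "first_row_mat p A x n N \<in> carrier_mat p p" by (simp add: first_row_mat_def)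
  have "det (mat_delete (first_row_mat p A x n N) 0 a) = poly (omit_col_det p A (Suc a) N) x"
    if "a < p" for a
    unfolding omit_col_det_def poly_det using that
    by (intro arg_cong[where f = det] eq_matI) (auto simp: first_row_mat_def mat_delete_def)
  then show ?thesis
    using assms unfolding poly_first_row_det lincomb_def signed_minor_def
    by (subst laplace_expansion_row[OF c, of 0])
       (auto intro!: sum.cong simp: cofactor_def first_row_mat_def mult_ac)
qed

lemma first_row_det_repeated:
  assumes "1 \<le> i" "i < p"
  shows "poly (first_row_det p A (N + i) N) x = 0"
  unfolding poly_first_row_det
proof (rule det_identical_rows[of _ p 0 i])
  show "row (first_row_mat p A x (N + i) N) 0 = row (first_row_mat p A x (N + i) N) i"
    using assms by (intro eq_vecI) (auto simp: first_row_mat_def)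
qed (use assms in \<open>auto simp: first_row_mat_def\<close>)

text \<open>
  A determinant vanishes iff its columns are linearly dependent, that is, iff some nontrivial combination
  of the recursion polynomials vanishes at all indices that label the rows.
\<close>

lemma first_row_det_eq_0_iff:
  assumes "p \<ge> 1"
  shows "poly (first_row_det p A n N) x = 0 \<longleftrightarrow>
    (\<exists>c. (\<exists>a<p. c a \<noteq> 0) \<and> lincomb p A x c n = 0 \<and> (\<forall>i\<in>{1..<p}. lincomb p A x c (N + i) = 0))"
    (is "?L \<longleftrightarrow> ?R")
proof -
  let ?M = "first_row_mat p A x n N"
  have c: "?M \<in> carrier_mat p p" by (simp add: first_row_mat_def)
  have entry: "(?M *\<^sub>v v) $ i = lincomb p A x (\<lambda>a. v $ a) (if i = 0 then n else N + i)"
    if "v \<in> carrier_vec p" "i < p" for v i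
    using that by (auto simp: first_row_mat_def scalar_prod_def lincomb_def atLeast0LessThan mult.commute)
  have zero: "?M *\<^sub>v v = 0\<^sub>v p \<longleftrightarrow> lincomb p A x (\<lambda>a. v $ a) n = 0 \<and>
      (\<forall>i\<in>{1..<p}. lincomb p A x (\<lambda>a. v $ a) (N + i) = 0)" if "v \<in> carrier_vec p" for v
  proof -
    have "?M *\<^sub>v v = 0\<^sub>v p \<longleftrightarrow> (\<forall>i<p. (?M *\<^sub>v v) $ i = 0)" using c by (auto simp: vec_eq_iff)
    also have "\<dots> \<longleftrightarrow> (\<forall>i<p. lincomb p A x (\<lambda>a. v $ a) (if i = 0 then n else N + i) = 0)"
      using entry[OF that] by simp
    also have "\<dots> \<longleftrightarrow> lincomb p A x (\<lambda>a. v $ a) n = 0 \<and>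
        (\<forall>i\<in>{1..<p}. lincomb p A x (\<lambda>a. v $ a) (N + i) = 0)" using assms by force
    finally show ?thesis .
  qed
  have "?L \<longleftrightarrow> (\<exists>v. v \<in> carrier_vec p \<and> v \<noteq> 0\<^sub>v p \<and> ?M *\<^sub>v v = 0\<^sub>v p)"
    unfolding poly_first_row_det using det_0_iff_vec_prod_zero_field[OF c] by blast
  also have "\<dots> \<longleftrightarrow> ?R"
  proof
    assume "\<exists>v. v \<in> carrier_vec p \<and> v \<noteq> 0\<^sub>v p \<and> ?M *\<^sub>v v = 0\<^sub>v p"
    then obtain v where v: "v \<in> carrier_vec p" "v \<noteq> 0\<^sub>v p" "?M *\<^sub>v v = 0\<^sub>v p" by blast
    have "\<exists>a<p. v $ a \<noteq> 0" using v(1,2) by (auto simp: vec_eq_iff)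
    then show ?R using v zero[OF v(1)] by (intro exI[of _ "\<lambda>a. v $ a"]) simp
  next
    assume ?R
    then obtain d where d: "\<exists>a<p. d a \<noteq> 0" "lincomb p A x d n = 0"
      "\<And>i. i \<in> {1..<p} \<Longrightarrow> lincomb p A x d (N + i) = 0" by blast
    have "lincomb p A x (\<lambda>a. vec p d $ a) l = lincomb p A x d l" for l
      by (simp add: lincomb_def)
    moreover have "vec p d \<noteq> 0\<^sub>v p" using d(1) by (auto simp: vec_eq_iff)
    ultimately show "\<exists>v. v \<in> carrier_vec p \<and> v \<noteq> 0\<^sub>v p \<and> ?M *\<^sub>v v = 0\<^sub>v p"
      using d zero[of "vec p d"] by (intro exI[of _ "vec p d"]) auto
  qed
  finally show ?thesis .
qed

text \<open>
  The determinant vanishes at the indices \<open>N + 1, \<dots>, N + p - 1\<close> because two rows coincide, and at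
  \<open>N + p\<close> because the left eigenvector \<open>w\<close>, continued by zero, is a solution of the recursion that
  vanishes on all these rows. So it satisfies the eigenvector equations. If it also vanished at \<open>N\<close>,
  a nontrivial solution \<open>u\<close> would vanish on \<open>N, \<dots>, N + p - 1\<close>. This \<open>u\<close> satisfies all equations of
  the truncation but the last, and pairing with the right eigenvector \<open>v\<close>, whose last component is
  nonzero, gives the last one too. But then \<open>u\<close> is a left eigenvector whose last component is zero.
\<close>

lemma first_row_det_eigenvec:
  assumes p: "p \<ge> 1" and T: "banded p q T" and A: "recursion_A p q T \<nu> A"
    and \<nu>: "lower_unitriangular p \<nu>"
    and w: "eigenvec (Suc N) (transposed T) x w" and v: "eigenvec (Suc N) T x v" "v N \<noteq> 0"
    and last: "\<And>u. eigenvec (Suc N) (transposed T) x u \<Longrightarrow> u N \<noteq> 0"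
  shows "eigenvec (Suc N) (transposed T) x (\<lambda>l. poly (first_row_det p A l N) x)"
proof -
  let ?z = "\<lambda>l. poly (first_row_det p A l N) x"
  let ?lc = "lincomb p A x"
  define w' where "w' = (\<lambda>l. if l \<le> N then w l else 0)"
  have w'rec: "(\<Sum>m = n - q..n + p. T m n * w' m) = x * w' n" if "n \<le> N" for n
  proof -
    have "(\<Sum>m = n - q..n + p. T m n * w' m) = trunc_app (Suc N) (transposed T) w' n"
      by (rule band_sum[OF T, symmetric]) (simp add: w'_def)
    also have "\<dots> = trunc_app (Suc N) (transposed T) w n" by (rule trunc_app_cong) (auto simp: w'_def)
    finally show ?thesis using w that by (simp add: eigenvec_def w'_def)
  qed
  obtain c where c: "\<And>l. l < p \<Longrightarrow> ?lc c l = w' l" using lincomb_surj[OF A \<nu>] by blast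
  have cw: "?lc c l = w' l" if "l \<le> N + p" for l
  proof -
    have "?lc c l - w' l = 0"
    proof (rule recursion_zero[OF p T _ _ that, where x = x])
      fix n assume "n \<le> N"
      then show "(\<Sum>m = n - q..n + p. T m n * (?lc c m - w' m)) = x * (?lc c n - w' n)"
        using lincomb_recursion[OF A] w'rec by (simp add: right_diff_distrib sum_subtractf)
    qed (simp add: c)
    then show ?thesis by simp
  qed
  have "\<exists>a<p. c a \<noteq> 0"
  proof (rule ccontr)
    assume "\<not> ?thesis"
    then have "?lc c l = 0" for l by (simp add: lincomb_def)
    then have "w l = 0" if "l \<le> N" for l using cw[of l] that by (simp add: w'_def)
    then show False using w by (auto simp: eigenvec_def)
  qed
  moreover have "?lc c (N + p) = 0" "\<forall>i\<in>{1..<p}. ?lc c (N + i) = 0"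
    using cw p by (auto simp: w'_def)
  ultimately have "?z (N + p) = 0" using first_row_det_eq_0_iff[OF p] by blast
  then have z0: "?z m = 0" if "N < m" "m \<le> N + p" for m
    using first_row_det_repeated[of "m - N" p A N x] that by (cases "m = N + p") auto
  have ev: "trunc_app (Suc N) (transposed T) ?z n = x * ?z n" if "n \<le> N" for n
  proof -
    have "trunc_app (Suc N) (transposed T) ?z n = (\<Sum>m = n - q..n + p. T m n * ?z m)"
      by (rule band_sum[OF T]) (use z0 that in auto)
    also have "\<dots> = x * ?z n"
      unfolding first_row_det_lincomb[OF p] by (rule lincomb_recursion[OF A])
    finally show ?thesis .
  qed
  have "?z N \<noteq> 0"
  proof
    assume "?z N = 0"
    then obtain d where d: "\<exists>a<p. d a \<noteq> 0" "?lc d N = 0" "\<And>i. i \<in> {1..<p} \<Longrightarrow> ?lc d (N + i) = 0"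
      using first_row_det_eq_0_iff[OF p] by blast
    define u where "u = (\<lambda>l. if l < N then ?lc d l else 0)"
    have u: "u m = ?lc d m" if "m < N + p" for m
    proof -
      consider "m < N" | "m = N" | "m - N \<in> {1..<p}" "N + (m - N) = m" "\<not> m < N"
        using \<open>m < N + p\<close> by fastforce
      then show ?thesis using d(2) d(3)[of "m - N"] by cases (auto simp: u_def)
    qed
    have uev: "trunc_app (Suc N) (transposed T) u n = x * u n" if "n < N" for n
    proof -
      have "trunc_app (Suc N) (transposed T) u n = (\<Sum>m = n - q..n + p. T m n * u m)"
        by (rule band_sum[OF T]) (simp add: u_def)
      also have "\<dots> = (\<Sum>m = n - q..n + p. T m n * ?lc d m)"
        using that by (intro sum.cong) (auto simp: u)
      finally show ?thesis using that lincomb_recursion[OF A] by (simp add: u_def)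
    qed
    have "(\<Sum>i<Suc N. u i * trunc_app (Suc N) T v i) = (\<Sum>i<Suc N. trunc_app (Suc N) (transposed T) u i * v i)"
      by (rule trunc_app_adjoint)
    moreover have "(\<Sum>i<Suc N. u i * trunc_app (Suc N) T v i) = (\<Sum>i<Suc N. x * u i * v i)"
      using v by (intro sum.cong) (auto simp: eigenvec_def)
    ultimately have "trunc_app (Suc N) (transposed T) u N * v N = x * u N * v N"
      using uev by simp
    then have "trunc_app (Suc N) (transposed T) u N = x * u N" using v by simp
    then have "trunc_app (Suc N) (transposed T) u n = x * u n" if "n < Suc N" for n
      using uev that by (cases "n = N") auto
    moreover have "\<exists>l<Suc N. u l \<noteq> 0"
    proof (rule ccontr)
      assume "\<not> ?thesis"
      then have "?lc d l = 0" if "l < p" for l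
        using u[of l] that by (cases "l < Suc N") (auto simp: u_def)
      then have "d a = 0" if "a < p" for a using lincomb_coeff[OF A \<nu> that, of x d] by simp
      then show False using d(1) by blast
    qed
    ultimately have "eigenvec (Suc N) (transposed T) x u" by (simp add: eigenvec_def)
    then show False using last by (fastforce simp: u_def)
  qed
  then show ?thesis using ev by (auto simp: eigenvec_def)
qed

text \<open>
  Pairing with the dual basis of the initial values recovers the coefficients of a solution.
\<close>

lemma signed_minor_eq_pairing:
  assumes "p \<ge> 1" "p \<le> N" "recursion_A p q T \<nu> A" "lower_unitriangular p \<nu>" "a \<in> {1..p}"
  shows "(\<Sum>l<Suc N. poly (first_row_det p A l N) x * e_nu p \<nu> a l) = signed_minor p A x N (a - 1)"
proof -
  have "(\<Sum>l<Suc N. poly (first_row_det p A l N) x * e_nu p \<nu> a l) =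
      (\<Sum>l<p. poly (first_row_det p A l N) x * e_nu p \<nu> a l)"
    using assms(2) by (intro sum.mono_neutral_right) (auto simp: e_nu_def)
  moreover have "a - 1 < p" "Suc (a - 1) = a" using assms(5) by auto
  ultimately show ?thesis
    using lincomb_coeff[OF assms(3,4), of "a - 1" x "signed_minor p A x N"]
    by (simp only: first_row_det_lincomb[OF assms(1)])
qed

section \<open>Truncations of a positive bidiagonal factorization\<close>

text \<open>
  Truncation is compatible with lower triangular factors on the left and upper triangular ones on the
  right, so the truncation of \<open>T\<close> is the product of the truncated factors.
\<close>

lemma semi_mult_lower:
  assumes "\<And>l. l > i \<Longrightarrow> F i l = 0" "i < n"
  shows "semi_mult F M i j = trunc_mult n F M i j"
  unfolding semi_mult_def trunc_mult_def using assms by (intro suminf_finite) auto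

lemma semi_mult_upper:
  assumes "\<And>l. l > j \<Longrightarrow> M l j = 0" "j < n"
  shows "semi_mult F M i j = trunc_mult n F M i j"
  unfolding semi_mult_def trunc_mult_def using assms by (intro suminf_finite) auto

lemma semi_mult_diag: "semi_mult (semi_diag D) M i j = D i * M i j"
  unfolding semi_mult_def by (subst suminf_finite[of "{i}"]) (auto simp: semi_diag_def)

text \<open>
  The diagonal factor can be absorbed into the leftmost factor of the product that follows it.
\<close>

lemma bidiag_prod_scale:
  assumes d: "\<And>i. d i > 0"
  shows "bidiag_prod n l u M \<Longrightarrow> bidiag_prod n l u (\<lambda>i j. d i * M i j)"
proof (induction rule: bidiag_prod.induct)
  case (lower F)
  then show ?case using d by (intro bidiag_prod.lower) (simp add: pos_lower_def)
next
  case (upper F)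
  then show ?case using d by (intro bidiag_prod.upper) (simp add: pos_lower_def transposed_def)
next
  case (mult l u F l' u' G)
  have "(\<lambda>i j. d i * trunc_mult n F G i j) = trunc_mult n (\<lambda>i j. d i * F i j) G"
    by (simp add: trunc_mult_def sum_distrib_left mult.assoc fun_eq_iff)
  then show ?case using bidiag_prod.mult[OF mult.IH(1) mult.hyps(2)] by simp
next
  case (cong l u F G)
  show ?case by (rule bidiag_prod.cong[OF cong.IH]) (simp add: cong.hyps)
qed

lemma bidiag_prod_upper_factors:
  assumes "\<And>F. F \<in> set Us \<Longrightarrow> pos_lower n (transposed F)" "\<And>F l j. F \<in> set Us \<Longrightarrow> l > j \<Longrightarrow> F l j = 0"
  shows "(\<forall>l j. l > j \<longrightarrow> semi_prod Us l j = 0) \<and>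
     (Us \<noteq> [] \<longrightarrow> bidiag_prod n False True (semi_prod Us))"
  using assms
proof (induction Us)
  case Nil
  then show ?case by (simp add: semi_prod_def semi_id_def)
next
  case (Cons F Us)
  let ?X = "semi_prod Us"
  have F: "pos_lower n (transposed F)" "\<And>l j. l > j \<Longrightarrow> F l j = 0" using Cons.prems by auto
  have X: "\<And>l j. l > j \<Longrightarrow> ?X l j = 0" "Us \<noteq> [] \<Longrightarrow> bidiag_prod n False True ?X"
    using Cons by auto
  have eq: "semi_prod (F # Us) = semi_mult F ?X" by (simp add: semi_prod_def)
  have "semi_mult F ?X l j = 0" if "l > j" for l j
  proof -
    have "F l m * ?X m j = 0" for m using F(2)[of m l] X(1)[of j m] that by (cases "m < l") auto
    then have "(\<lambda>m. F l m * ?X m j) = (\<lambda>m. 0)" by blast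
    then show ?thesis by (simp only: semi_mult_def suminf_zero)
  qed
  moreover have sm: "trunc_mult n F ?X i j = semi_mult F ?X i j" if "j < n" for i j
    using semi_mult_upper[of j ?X n F i] X(1) that by simp
  have "bidiag_prod n False True (semi_mult F ?X)"
  proof (cases "Us = []")
    case True
    have "F i j = semi_mult F ?X i j" if "j < n" for i j
      using that unfolding sm[OF that, symmetric] trunc_mult_def
      by (simp add: True semi_prod_def semi_id_def if_distrib[of "(*) _"] cong: if_cong)
    then show ?thesis by (intro bidiag_prod.cong[OF bidiag_prod.upper[OF F(1)]])
  next
    case False
    have "bidiag_prod n (False \<or> False) (True \<or> True) (trunc_mult n F ?X)"
      by (intro bidiag_prod.mult bidiag_prod.upper F X False)
    then have "bidiag_prod n False True (trunc_mult n F ?X)" by simp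
    then show ?thesis by (rule bidiag_prod.cong) (rule sm)
  qed
  ultimately show ?case by (simp add: eq)
qed

lemma bidiag_prod_lower_factors:
  assumes X: "bidiag_prod n l u X"
    and "\<And>F. F \<in> set Ls \<Longrightarrow> pos_lower n F" "\<And>F i j. F \<in> set Ls \<Longrightarrow> i < j \<Longrightarrow> F i j = 0"
  shows "bidiag_prod n (Ls \<noteq> [] \<or> l) u (foldr semi_mult Ls X)"
  using assms(2,3)
proof (induction Ls)
  case (Cons F Ls)
  have "bidiag_prod n (True \<or> Ls \<noteq> [] \<or> l) (False \<or> u) (trunc_mult n F (foldr semi_mult Ls X))"
    using Cons by (intro bidiag_prod.mult bidiag_prod.lower) auto
  then have "bidiag_prod n True u (trunc_mult n F (foldr semi_mult Ls X))" by simp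
  then have "bidiag_prod n True u (semi_mult F (foldr semi_mult Ls X))"
    by (rule bidiag_prod.cong) (rule semi_mult_lower[symmetric], use Cons in auto)
  then show ?case by simp
qed (use X in simp)

lemma PBF_bidiag_prod:
  assumes pq: "p \<ge> 1" "q \<ge> 1" and T: "is_PBF p q T L D U"
  shows "bidiag_prod n True True T"
proof -
  let ?Ls = "map (\<lambda>k. lower_bidiag (L k)) [1..<p + 1]"
  let ?Us = "map (\<lambda>k. upper_bidiag (U k)) (rev [1..<q + 1])"
  have T_eq: "T = foldr semi_mult ?Ls (semi_mult (semi_diag D) (semi_prod ?Us))"
    using T by (simp add: is_PBF_def semi_prod_def)
  have "pos_lower n (transposed F)" "l > j \<Longrightarrow> F l j = 0" if "F \<in> set ?Us" for F l j
    using T that by (auto simp: is_PBF_def pos_lower_def transposed_def upper_bidiag_def)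
  then have "bidiag_prod n False True (semi_prod ?Us)"
    using bidiag_prod_upper_factors[of ?Us n] pq by simp
  then have "bidiag_prod n False True (\<lambda>i j. D i * semi_prod ?Us i j)"
    using T by (intro bidiag_prod_scale) (auto simp: is_PBF_def)
  then have "bidiag_prod n False True (semi_mult (semi_diag D) (semi_prod ?Us))"
    by (rule bidiag_prod.cong) (simp add: semi_mult_diag)
  moreover have "pos_lower n F" "i < j \<Longrightarrow> F i j = 0" if "F \<in> set ?Ls" for F i j
    using T that by (auto simp: is_PBF_def pos_lower_def lower_bidiag_def)
  ultimately have "bidiag_prod n (?Ls \<noteq> [] \<or> False) True T"
    unfolding T_eq by (rule bidiag_prod_lower_factors)
  then show ?thesis using pq by simp
qed

lemma eigenvalue_trunc_iff: "eigenvalue (trunc T N) x \<longleftrightarrow> (\<exists>v. eigenvec (Suc N) T x v)"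
proof
  have c: "trunc T N \<in> carrier_mat (Suc N) (Suc N)" by (simp add: trunc_def)
  have entry: "(trunc T N *\<^sub>v v) $ i = trunc_app (Suc N) T (\<lambda>j. v $ j) i"
    if "v \<in> carrier_vec (Suc N)" "i < Suc N" for v i
    using that by (simp add: trunc_def trunc_app_def scalar_prod_def atLeast0LessThan)
  {
    assume "eigenvalue (trunc T N) x"
    then obtain v where v: "v \<in> carrier_vec (Suc N)" "v \<noteq> 0\<^sub>v (Suc N)" "trunc T N *\<^sub>v v = x \<cdot>\<^sub>v v"
      using c by (auto simp: eigenvalue_def eigenvector_def)
    have "trunc_app (Suc N) T (\<lambda>j. v $ j) i = x * v $ i" if "i < Suc N" for i
      using arg_cong[OF v(3), of "\<lambda>u. u $ i"] entry[OF v(1) that] that v(1) by simp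
    moreover have "\<exists>i<Suc N. v $ i \<noteq> 0" using v(1,2) by (auto simp: vec_eq_iff)
    ultimately show "\<exists>v. eigenvec (Suc N) T x v" unfolding eigenvec_def by blast
  next
    assume "\<exists>v. eigenvec (Suc N) T x v"
    then obtain v where v: "eigenvec (Suc N) T x v" by blast
    let ?v = "vec (Suc N) v"
    have "trunc_app (Suc N) T (\<lambda>j. ?v $ j) i = trunc_app (Suc N) T v i" for i by (rule trunc_app_cong) auto
    then have "trunc T N *\<^sub>v ?v = x \<cdot>\<^sub>v ?v"
      using v c by (intro eq_vecI) (auto simp: entry eigenvec_def simp del: index_mult_mat_vec)
    moreover have "?v \<noteq> 0\<^sub>v (Suc N)" using v by (auto simp: vec_eq_iff eigenvec_def)
    ultimately show "eigenvalue (trunc T N) x"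
      using c by (auto simp: eigenvalue_def eigenvector_def intro!: exI[of _ ?v])
  }
qed

text \<open>
  The product has \<open>N + 1\<close> eigenvalues, as many as the degree of the characteristic polynomial allows,
  so every index in \<open>{1..N + 1}\<close> of the sorted list of zeros is valid.
\<close>

lemma zero_of_enumerates:
  assumes T: "bidiag_prod (Suc N) True True T"
  shows "inj_on (zero_of T N) {1..N + 1}"
    "k \<in> {1..N + 1} \<Longrightarrow> eigenvalue (trunc T N) (zero_of T N k)"
proof -
  let ?P = "char_poly (trunc T N)"
  define Z where "Z = {x. poly ?P x = 0}"
  have c: "trunc T N \<in> carrier_mat (Suc N) (Suc N)" by (simp add: trunc_def)
  have deg: "degree ?P = Suc N" "monic ?P" using degree_monic_char_poly[OF c] by auto
  then have "?P \<noteq> 0" using leading_coeff_0_iff[of ?P] by simp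
  then have fin: "finite Z" and le: "card Z \<le> Suc N"
    unfolding Z_def using poly_roots_finite[of ?P] card_poly_roots_bound[of ?P] deg(1) by simp_all
  have Z: "x \<in> Z \<longleftrightarrow> eigenvalue (trunc T N) x" for x
    unfolding Z_def using eigenvalue_root_char_poly[OF c] by simp
  obtain E where E: "finite E" "card E = Suc N" "\<And>\<mu>. \<mu> \<in> E \<Longrightarrow> \<exists>x. eigenvec (Suc N) T \<mu> x"
    using bidiag_prod_spectrum[OF T] by blast
  have "E \<subseteq> Z"
  proof
    fix \<mu> assume "\<mu> \<in> E"
    then show "\<mu> \<in> Z" unfolding Z eigenvalue_trunc_iff by (rule E(3))
  qed
  then have card: "card Z = Suc N" using card_mono[OF fin, of E] E(2) le by simp
  define xs where "xs = rev (sorted_list_of_set Z)"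
  have xs: "distinct xs" "length xs = Suc N" "set xs = Z"
    unfolding xs_def using fin card by simp_all
  have zero: "zero_of T N k = xs ! (k - 1)" for k unfolding zero_of_def xs_def Z_def ..
  show "inj_on (zero_of T N) {1..N + 1}"
  proof (rule inj_onI)
    fix j k assume jk: "j \<in> {1..N + 1}" "k \<in> {1..N + 1}" "zero_of T N j = zero_of T N k"
    then have "j - 1 < length xs" "k - 1 < length xs" using xs(2) by auto
    then have "j - 1 = k - 1"
      using nth_eq_iff_index_eq[OF xs(1)] jk(3) unfolding zero by blast
    then show "j = k" using jk(1,2) unfolding atLeastAtMost_iff by linarith
  qed
  show "eigenvalue (trunc T N) (zero_of T N k)" if "k \<in> {1..N + 1}"
  proof -
    have "k - 1 < length xs" using that xs(2) unfolding atLeastAtMost_iff by linarith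
    then have "zero_of T N k \<in> Z" unfolding zero xs(3)[symmetric] by (rule nth_mem)
    then show ?thesis using Z by simp
  qed
qed

section \<open>Spectral decomposition and Gaussian quadrature\<close>

lemma eigenvec_independent:
  assumes "finite J" "\<And>k. k \<in> J \<Longrightarrow> eigenvec n M (x k) (v k)" "inj_on x J"
    "\<And>i. i < n \<Longrightarrow> (\<Sum>k\<in>J. c k * v k i) = 0"
  shows "\<forall>k\<in>J. c k = 0"
  using assms
proof (induction J arbitrary: c rule: finite_induct)
  case (insert k0 J)
  have trunc_app_sum: "trunc_app n M (\<lambda>i. \<Sum>k\<in>insert k0 J. c k * v k i) i = (\<Sum>k\<in>insert k0 J. c k * trunc_app n M (v k) i)"
    for i unfolding trunc_app_def sum_distrib_left by (subst sum.swap) (simp add: mult_ac)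
  have "(\<Sum>k\<in>J. (c k * (x k - x k0)) * v k i) = 0" if i: "i < n" for i
  proof -
    have "trunc_app n M (\<lambda>i. \<Sum>k\<in>insert k0 J. c k * v k i) i = 0"
      unfolding trunc_app_def using insert.prems(3) by simp
    then have "(\<Sum>k\<in>insert k0 J. c k * (x k * v k i)) = 0"
      unfolding trunc_app_sum using insert.prems(1) i by (simp add: eigenvec_def insert.hyps)
    moreover have "x k0 * (\<Sum>k\<in>insert k0 J. c k * v k i) = 0"
      using insert.prems(3)[OF i] by simp
    ultimately have "(\<Sum>k\<in>insert k0 J. c k * (x k * v k i)) -
        x k0 * (\<Sum>k\<in>insert k0 J. c k * v k i) = 0" by simp
    then have "(\<Sum>k\<in>insert k0 J. (c k * (x k - x k0)) * v k i) = 0"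
      unfolding sum_distrib_left sum_subtractf[symmetric] by (simp add: algebra_simps)
    then show ?thesis using insert.hyps by simp
  qed
  then have "\<forall>k\<in>J. c k * (x k - x k0) = 0" using insert.prems by (intro insert.IH) auto
  moreover have "x k \<noteq> x k0" if "k \<in> J" for k using insert.prems(2) insert.hyps(2) that by (metis inj_on_eq_iff insertI1 insertI2)
  ultimately have J: "\<forall>k\<in>J. c k = 0" by auto
  obtain i where "i < n" "v k0 i \<noteq> 0" using insert.prems(1)[of k0] by (auto simp: eigenvec_def)
  then have "c k0 = 0" using insert.prems(3)[of i] J insert.hyps by simp
  then show ?case using J by simp
qed simp

lemma eigenvec_mat_det:
  assumes "\<And>k. k < n \<Longrightarrow> eigenvec n M (x k) (v k)" "inj_on x {..<n}"
  shows "det (mat n n (\<lambda>(i, k). v k i)) \<noteq> 0"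
proof
  let ?V = "mat n n (\<lambda>(i, k). v k i)"
  assume "det ?V = 0"
  then obtain c where c: "c \<in> carrier_vec n" "c \<noteq> 0\<^sub>v n" "?V *\<^sub>v c = 0\<^sub>v n"
    using det_0_iff_vec_prod_zero_field[of ?V n] by auto
  have "(\<Sum>k<n. c $ k * v k i) = 0" if "i < n" for i
    using arg_cong[OF c(3), of "\<lambda>u. u $ i"] that c(1)
    by (simp add: scalar_prod_def atLeast0LessThan mult.commute)
  then have "\<forall>k<n. c $ k = 0"
    using eigenvec_independent[of "{..<n}" n M x v "\<lambda>k. c $ k"] assms by auto
  then show False using c(1,2) by (auto simp: vec_eq_iff)
qed

text \<open>
  Left and right eigenvectors for different eigenvalues are orthogonal, so the product of the two
  eigenvector matrices is diagonal. Both matrices are invertible, hence no diagonal entry vanishes, and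
  after normalization they are inverse to each other.
\<close>

lemma spectral_decomposition:
  assumes v: "\<And>k. k < n \<Longrightarrow> eigenvec n M (x k) (v k)"
    and w: "\<And>k. k < n \<Longrightarrow> eigenvec n (transposed M) (x k) (w k)"
    and x: "inj_on x {..<n}"
  shows "(\<Sum>i<n. g i * (trunc_app n M ^^ m) f i) =
    (\<Sum>k<n. (\<Sum>i<n. v k i * g i) * (\<Sum>i<n. w k i * f i) / (\<Sum>i<n. w k i * v k i) * x k ^ m)"
proof -
  define d where "d = (\<lambda>k. \<Sum>i<n. w k i * v k i)"
  define V where "V = mat n n (\<lambda>(i, k). v k i)"
  define W where "W = mat n n (\<lambda>(i, k). w k i)"
  have VW: "V \<in> carrier_mat n n" "W \<in> carrier_mat n n" by (auto simp: V_def W_def)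
  have orth: "(\<Sum>i<n. w j i * v k i) = 0" if "j < n" "k < n" "j \<noteq> k" for j k
  proof -
    have "(\<Sum>i<n. w j i * trunc_app n M (v k) i) = x k * (\<Sum>i<n. w j i * v k i)"
      unfolding sum_distrib_left using v[OF that(2)] by (auto simp: eigenvec_def mult_ac)
    moreover have "(\<Sum>i<n. w j i * trunc_app n M (v k) i) = x j * (\<Sum>i<n. w j i * v k i)"
      unfolding trunc_app_adjoint sum_distrib_left using w[OF that(1)] by (auto simp: eigenvec_def mult_ac)
    moreover have "x j \<noteq> x k" using x that by (auto simp: inj_on_def)
    ultimately show ?thesis by simp
  qed
  have WV: "transpose_mat W * V = mat n n (\<lambda>(j, k). if j = k then d k else 0)"
    by (intro eq_matI) (auto simp: V_def W_def scalar_prod_def atLeast0LessThan orth d_def)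
  have "diag_mat (mat n n (\<lambda>(j, k). if j = k then d k else 0)) = map d [0..<n]"
    by (auto simp: diag_mat_def)
  then have "det (transpose_mat W * V) = prod_list (map d [0..<n])"
    unfolding WV by (subst det_upper_triangular[of _ n]) auto
  moreover have "det (transpose_mat W * V) \<noteq> 0"
    using eigenvec_mat_det[OF v x] eigenvec_mat_det[OF w x] det_transpose[OF VW(2)] VW
    by (simp add: det_mult[of _ n] V_def W_def)
  ultimately have d: "d k \<noteq> 0" if "k < n" for k using that by (auto simp: prod_list_zero_iff)
  define W' where "W' = mat n n (\<lambda>(k, i). w k i / d k)"
  have W': "W' \<in> carrier_mat n n" by (simp add: W'_def)
  have wv: "(\<Sum>i<n. w k i * v k i) / d k = 1" if "k < n" for k
    using d[OF that] by (simp add: d_def)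
  have "W' * V = 1\<^sub>m n"
    by (intro eq_matI)
       (auto simp: V_def W'_def scalar_prod_def atLeast0LessThan orth wv simp flip: sum_divide_distrib)
  then have VW': "V * W' = 1\<^sub>m n" using mat_mult_left_right_inverse[OF W' VW(1)] by simp
  have f: "f i = (\<Sum>k<n. (\<Sum>j<n. w k j * f j) / d k * v k i)" if i: "i < n" for i
  proof -
    have id: "(\<Sum>k<n. v k i * (w k j / d k)) = (if i = j then 1 else 0)" if "j < n" for j
    proof -
      have "(V * W') $$ (i, j) = (\<Sum>k<n. v k i * (w k j / d k))"
        using i that by (simp add: V_def W'_def scalar_prod_def atLeast0LessThan)
      then show ?thesis using i that by (simp add: VW')
    qed
    have "(\<Sum>k<n. (\<Sum>j<n. w k j * f j) / d k * v k i) =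
        (\<Sum>j<n. (\<Sum>k<n. v k i * (w k j / d k)) * f j)"
      unfolding sum_distrib_left sum_distrib_right sum_divide_distrib
      by (subst sum.swap) (simp add: mult_ac)
    also have "\<dots> = (\<Sum>j<n. (if i = j then 1 else 0) * f j)"
      by (intro sum.cong refl) (simp only: id lessThan_iff)
    also have "\<dots> = f i" using i by (simp add: if_distrib[of "\<lambda>t. t * _"] cong: if_cong)
    finally show ?thesis by simp
  qed
  have pow: "(trunc_app n M ^^ m) f i = (\<Sum>k<n. (\<Sum>j<n. w k j * f j) / d k * x k ^ m * v k i)"
    if "i < n" for i
    using that
  proof (induction m arbitrary: i)
    case (Suc m)
    have "(trunc_app n M ^^ Suc m) f i =
        trunc_app n M (\<lambda>i. \<Sum>k<n. (\<Sum>j<n. w k j * f j) / d k * x k ^ m * v k i) i"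
      unfolding funpow.simps o_apply using Suc.IH by (intro trunc_app_cong) auto
    also have "\<dots> = (\<Sum>k<n. (\<Sum>j<n. w k j * f j) / d k * x k ^ m * trunc_app n M (v k) i)"
      unfolding trunc_app_def[of n M] sum_distrib_left by (subst sum.swap) (simp add: mult_ac)
    also have "\<dots> = (\<Sum>k<n. (\<Sum>j<n. w k j * f j) / d k * x k ^ Suc m * v k i)"
      using v Suc.prems by (intro sum.cong) (auto simp: eigenvec_def)
    finally show ?case .
  qed (use f in simp)
  have "(\<Sum>i<n. g i * (trunc_app n M ^^ m) f i) =
      (\<Sum>i<n. \<Sum>k<n. g i * ((\<Sum>j<n. w k j * f j) / d k * x k ^ m * v k i))"
    by (simp add: pow sum_distrib_left)
  also have "\<dots> = (\<Sum>k<n. \<Sum>i<n. v k i * g i * ((\<Sum>j<n. w k j * f j) / d k * x k ^ m))"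
    by (subst sum.swap) (simp add: mult_ac)
  also have "\<dots> = (\<Sum>k<n. (\<Sum>i<n. v k i * g i) * (\<Sum>i<n. w k i * f i) / d k * x k ^ m)"
    by (simp only: sum_distrib_right[symmetric]) (simp add: mult.assoc)
  finally show ?thesis by (simp add: d_def)
qed

text \<open>
  Transposing \<open>T\<close> exchanges the roles of $A$ and $B$, so everything about the right eigenvectors
  follows from the left ones.
\<close>

lemma recursion_B_transp: "recursion_B p q T \<xi> B \<longleftrightarrow> recursion_A q p (transposed T) \<xi> B"
  by (simp add: recursion_A_def recursion_B_def transposed_def)

lemma banded_transp: "banded p q T \<Longrightarrow> banded q p (transposed T)"
  by (auto simp: banded_def transposed_def)

text \<open>
  In the product $\rho\,\mu$ the factors $\beta_N$ cancel, and what remains are the pairings of the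
  determinantal eigenvectors with \<open>e_xi\<close> and \<open>e_nu\<close>, divided by their mutual pairing.
\<close>

lemma christoffel_quadrature:
  assumes pq: "p \<ge> 1" "q \<ge> 1" "p \<le> N" "q \<le> N" and T: "banded p q T"
    and bid: "bidiag_prod (Suc N) True True T"
    and \<nu>: "lower_unitriangular p \<nu>" and \<xi>: "lower_unitriangular q \<xi>"
    and A: "recursion_A p q T \<nu> A" and B: "recursion_B p q T \<xi> B"
    and ab: "a \<in> {1..p}" "b \<in> {1..q}"
  shows "(\<Sum>k = 1..N + 1. christoffel_rho q T B N k b * christoffel_mu p q T A B N k a *
      zero_of T N k ^ m) = (\<Sum>i<Suc N. e_xi q \<xi> b i * (trunc_app (Suc N) T ^^ m) (e_nu p \<nu> a) i)"
proof -
  have B': "recursion_A q p (transposed T) \<xi> B" using B by (simp add: recursion_B_transp)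
  note T' = banded_transp[OF T]
  have bid': "bidiag_prod (Suc N) True True (transposed T)" using bidiag_prod_transp[OF bid] .
  define x where "x = (\<lambda>k. zero_of T N (Suc k))"
  have x: "inj_on x {..<Suc N}"
    unfolding x_def using zero_of_enumerates(1)[OF bid] by (intro inj_onI) (auto dest!: inj_onD)
  have last: "v N \<noteq> 0" if "eigenvec (Suc N) T y v" for y v
    using bidiag_prod_spectrum[OF bid] that by force
  have last': "v N \<noteq> 0" if "eigenvec (Suc N) (transposed T) y v" for y v
    using bidiag_prod_spectrum[OF bid'] that by force
  define w where "w = (\<lambda>k l. poly (first_row_det p A l N) (x k))"
  define v where "v = (\<lambda>k l. poly (first_row_det q B l N) (x k))"
  have vw: "eigenvec (Suc N) T (x k) (v k)" "eigenvec (Suc N) (transposed T) (x k) (w k)"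
    if k: "k < Suc N" for k
  proof -
    have ev: "eigenvalue (trunc T N) (x k)"
      unfolding x_def using k by (intro zero_of_enumerates(2)[OF bid]) auto
    then obtain v' where v': "eigenvec (Suc N) T (x k) v'" using eigenvalue_trunc_iff by blast
    have "transpose_mat (trunc T N) = trunc (transposed T) N" by (intro eq_matI) (auto simp: trunc_def transposed_def)
    then have "eigenvalue (trunc (transposed T) N) (x k)"
      using ev eigenvalue_root_char_poly[of "trunc T N" "Suc N" "x k"]
        eigenvalue_root_char_poly[of "trunc (transposed T) N" "Suc N" "x k"]
        char_poly_transpose_mat[of "trunc T N" "Suc N"] by (simp add: trunc_def)
    then obtain w' where w': "eigenvec (Suc N) (transposed T) (x k) w'" using eigenvalue_trunc_iff by blast
    show "eigenvec (Suc N) (transposed T) (x k) (w k)"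
      unfolding w_def by (rule first_row_det_eigenvec[OF pq(1) T A \<nu> w' v' last[OF v']]) (rule last')
    have "eigenvec (Suc N) (transposed (transposed T)) (x k) (v k)"
      unfolding v_def using v' last
      by (intro first_row_det_eigenvec[OF pq(2) T' B' \<xi> _ w' last'[OF w']]) auto
    then show "eigenvec (Suc N) T (x k) (v k)" by simp
  qed
  have \<beta>: "beta_coeff q T N \<noteq> 0" using T by (simp add: beta_coeff_def banded_def)
  have "(\<Sum>k = 1..N + 1. christoffel_rho q T B N k b * christoffel_mu p q T A B N k a *
      zero_of T N k ^ m) = (\<Sum>k<Suc N. christoffel_rho q T B N (Suc k) b *
      christoffel_mu p q T A B N (Suc k) a * x k ^ m)"
    by (simp add: sum.atLeast1_atMost_eq x_def)
  also have "\<dots> = (\<Sum>k<Suc N. (\<Sum>i<Suc N. v k i * e_xi q \<xi> b i) * (\<Sum>i<Suc N. w k i * e_nu p \<nu> a i) /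
      (\<Sum>i<Suc N. w k i * v k i) * x k ^ m)"
  proof (intro sum.cong refl)
    fix k
    have "Suc (a - 1) = a" "Suc (b - 1) = b" using ab by auto
    moreover have "(\<Sum>i<Suc N. w k i * e_nu p \<nu> a i) = signed_minor p A (x k) N (a - 1)"
      unfolding w_def using signed_minor_eq_pairing[OF pq(1,3) A \<nu> ab(1)] .
    moreover have "(\<Sum>i<Suc N. v k i * e_xi q \<xi> b i) = signed_minor q B (x k) N (b - 1)"
      unfolding v_def e_xi_eq_e_nu[OF \<xi> ab(2)] using signed_minor_eq_pairing[OF pq(2,4) B' \<xi> ab(2)] .
    moreover have "(\<Sum>i<Suc N. w k i * v k i) = (\<Sum>l = 0..N. poly (first_row_det p A l N) (x k) *
        poly (first_row_det q B l N) (x k))"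
      by (simp add: w_def v_def atLeast0AtMost lessThan_Suc_atMost)
    ultimately show "christoffel_rho q T B N (Suc k) b * christoffel_mu p q T A B N (Suc k) a * x k ^ m =
      (\<Sum>i<Suc N. v k i * e_xi q \<xi> b i) * (\<Sum>i<Suc N. w k i * e_nu p \<nu> a i) /
      (\<Sum>i<Suc N. w k i * v k i) * x k ^ m"
      using \<beta> by (simp add: christoffel_rho_def christoffel_mu_def signed_minor_def x_def)
  qed
  also have "\<dots> = (\<Sum>i<Suc N. e_xi q \<xi> b i * (trunc_app (Suc N) T ^^ m) (e_nu p \<nu> a) i)"
    using spectral_decomposition[of "Suc N" T x v w "e_xi q \<xi> b" m "e_nu p \<nu> a"] vw x by simp
  finally show ?thesis .
qed

section \<open>Moments of the biorthogonality measures\<close>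

lemma semi_pow_0: "semi_pow T 0 = semi_id"
  and semi_pow_Suc: "semi_pow T (Suc n) = semi_mult T (semi_pow T n)"
  by (simp_all add: semi_pow_def semi_prod_def)

lemma semi_mult_banded:
  assumes "banded p q T"
  shows "semi_mult T M i j = (\<Sum>l = i - p..i + q. T i l * M l j)"
  unfolding semi_mult_def using assms by (intro suminf_finite) (auto simp: banded_def)

lemma semi_form_finite_support:
  assumes "\<And>i. i \<ge> m \<Longrightarrow> u i = 0" "\<And>j. j \<ge> n \<Longrightarrow> v j = 0"
  shows "semi_form u M v = (\<Sum>i<m. \<Sum>j<n. u i * M i j * v j)"
proof -
  have "(\<Sum>j. u i * M i j * v j) = (\<Sum>j<n. u i * M i j * v j)" for i
    using assms(2) by (intro suminf_finite) auto
  then show ?thesis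
    unfolding semi_form_def using assms(1) by (subst suminf_finite[of "{..<m}"]) auto
qed

text \<open>
  Iterating the recursion for $B$ inside the biorthogonality relation yields the entries of \<open>T\<close> to the
  power \<open>n\<close>. For \<open>l < q\<close> and \<open>k < p\<close> the polynomials are constants, and the matrices of these
  constants can be inverted.
\<close>

lemma moments_from_biorthogonality:
  fixes \<phi> :: "nat \<Rightarrow> nat \<Rightarrow> real poly \<Rightarrow> real"
  assumes T: "banded p q T" and \<nu>: "lower_unitriangular p \<nu>" and \<xi>: "lower_unitriangular q \<xi>"
    and A: "recursion_A p q T \<nu> A" and B: "recursion_B p q T \<xi> B"
    and add: "\<And>a b P Q. a \<in> {1..p} \<Longrightarrow> b \<in> {1..q} \<Longrightarrow> \<phi> b a (P + Q) = \<phi> b a P + \<phi> b a Q"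
    and smult: "\<And>a b c P. a \<in> {1..p} \<Longrightarrow> b \<in> {1..q} \<Longrightarrow>
      \<phi> b a (Polynomial.smult c P) = c * \<phi> b a P"
    and biorth: "\<And>k l. (\<Sum>a = 1..p. \<Sum>b = 1..q. \<phi> b a (B b l * A a k)) = (if k = l then 1 else 0)"
    and ab: "a0 \<in> {1..p}" "b0 \<in> {1..q}"
  shows "\<phi> b0 a0 ([:0, 1:] ^ n) = semi_form (e_xi q \<xi> b0) (semi_pow T n) (e_nu p \<nu> a0)"
proof -
  define X where "X = [:0, 1 :: real:]"
  have sum: "\<phi> b a (\<Sum>i\<in>I. f i) = (\<Sum>i\<in>I. \<phi> b a (f i))"
    if "a \<in> {1..p}" "b \<in> {1..q}" "finite I" for a b f and I :: "nat set"
    using that(3)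
  proof (induction I rule: finite_induct)
    case empty
    then show ?case using smult[OF that(1,2), of 0 0] by simp
  qed (simp add: add[OF that(1,2)])
  have pow: "(\<Sum>a = 1..p. \<Sum>b = 1..q. \<phi> b a (X ^ n * B b l * A a k)) = semi_pow T n l k" for n l k
  proof (induction n arbitrary: l)
    case 0
    then show ?case using biorth[of l k] by (auto simp: semi_pow_0 semi_id_def)
  next
    case (Suc n)
    have step: "\<phi> b a (X ^ Suc n * B b l * A a k) =
        (\<Sum>m = l - p..l + q. T l m * \<phi> b a (X ^ n * B b m * A a k))"
      if "a \<in> {1..p}" "b \<in> {1..q}" for a b
    proof -
      have "(\<Sum>m = l - p..l + q. Polynomial.smult (T l m) (B b m)) = X * B b l"
        using B that(2) unfolding recursion_B_def X_def by blast
      then have "X ^ Suc n * B b l * A a k =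
          X ^ n * A a k * (\<Sum>m = l - p..l + q. Polynomial.smult (T l m) (B b m))"
        by (simp add: mult_ac)
      also have "\<dots> = (\<Sum>m = l - p..l + q. Polynomial.smult (T l m) (X ^ n * B b m * A a k))"
        unfolding sum_distrib_left by (simp add: mult_ac)
      finally show ?thesis by (simp add: sum[OF that] smult[OF that])
    qed
    have "(\<Sum>a = 1..p. \<Sum>b = 1..q. \<phi> b a (X ^ Suc n * B b l * A a k)) =
        (\<Sum>a = 1..p. \<Sum>b = 1..q. \<Sum>m = l - p..l + q. T l m * \<phi> b a (X ^ n * B b m * A a k))"
      by (intro sum.cong refl step)
    also have "\<dots> = (\<Sum>a = 1..p. \<Sum>m = l - p..l + q. T l m * (\<Sum>b = 1..q. \<phi> b a (X ^ n * B b m * A a k)))"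
      unfolding sum_distrib_left by (rule sum.cong[OF refl], rule sum.swap)
    also have "\<dots> = (\<Sum>m = l - p..l + q. T l m *
        (\<Sum>a = 1..p. \<Sum>b = 1..q. \<phi> b a (X ^ n * B b m * A a k)))"
      unfolding sum_distrib_left[of "T l _" _ "{1..p}"] by (rule sum.swap)
    finally show ?case unfolding Suc.IH semi_pow_Suc semi_mult_banded[OF T] .
  qed
  define \<mu> where "\<mu> = (\<lambda>b a. \<phi> (Suc b) (Suc a) (X ^ n))"
  have init: "semi_pow T n l k = (\<Sum>a<p. \<Sum>b<q. \<nu> $$ (k, a) * (\<xi> $$ (l, b) * \<mu> b a))"
    if "l < q" "k < p" for l k
  proof -
    have "\<phi> (Suc b) (Suc a) (X ^ n * B (Suc b) l * A (Suc a) k) =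
        \<nu> $$ (k, a) * (\<xi> $$ (l, b) * \<mu> b a)" if "a < p" "b < q" for a b
    proof -
      have "Suc a \<in> {1..p}" "Suc b \<in> {1..q}" "Suc k \<in> {1..p}" "Suc l \<in> {1..q}"
        using that \<open>l < q\<close> \<open>k < p\<close> by auto
      then have "A (Suc a) (Suc k - 1) = [:\<nu> $$ (Suc k - 1, Suc a - 1):]"
        "B (Suc b) (Suc l - 1) = [:\<xi> $$ (Suc l - 1, Suc b - 1):]"
        using A B unfolding recursion_A_def recursion_B_def by blast+
      then have "X ^ n * B (Suc b) l * A (Suc a) k =
          Polynomial.smult (\<nu> $$ (k, a)) (Polynomial.smult (\<xi> $$ (l, b)) (X ^ n))" by simp
      then show ?thesis using that by (simp add: smult \<mu>_def)
    qed
    then show ?thesis unfolding pow[symmetric] One_nat_def sum.atLeast1_atMost_eq by simp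
  qed
  define a b where "a = a0 - 1" and "b = b0 - 1"
  have a: "a < p" "a0 = Suc a" and b: "b < q" "b0 = Suc b" using ab by (auto simp: a_def b_def)
  have xi: "e_xi q \<xi> (Suc b) = e_nu q \<xi> (Suc b)" using e_xi_eq_e_nu[OF \<xi>, of "Suc b"] b by simp
  have "semi_form (e_xi q \<xi> b0) (semi_pow T n) (e_nu p \<nu> a0) =
      (\<Sum>l<q. \<Sum>k<p. e_nu q \<xi> (Suc b) l * semi_pow T n l k * e_nu p \<nu> (Suc a) k)"
    unfolding a b xi by (rule semi_form_finite_support) (auto simp: e_nu_def)
  also have "\<dots> = (\<Sum>l<q. \<Sum>k<p. e_nu q \<xi> (Suc b) l *
      (\<Sum>a'<p. \<Sum>b'<q. \<nu> $$ (k, a') * (\<xi> $$ (l, b') * \<mu> b' a')) * e_nu p \<nu> (Suc a) k)"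
    by (intro sum.cong) (auto simp: init)
  also have "\<dots> = (\<Sum>l<q. \<Sum>k<p. \<Sum>a'<p. \<Sum>b'<q. (\<nu> $$ (k, a') * e_nu p \<nu> (Suc a) k) *
      ((\<xi> $$ (l, b') * e_nu q \<xi> (Suc b) l) * \<mu> b' a'))"
    by (simp add: sum_distrib_left sum_distrib_right mult_ac)
  also have "\<dots> = (\<Sum>l<q. \<Sum>a'<p. \<Sum>k<p. \<Sum>b'<q. (\<nu> $$ (k, a') * e_nu p \<nu> (Suc a) k) *
      ((\<xi> $$ (l, b') * e_nu q \<xi> (Suc b) l) * \<mu> b' a'))"
    by (rule sum.cong[OF refl], rule sum.swap)
  also have "\<dots> = (\<Sum>l<q. \<Sum>a'<p. (\<Sum>k<p. \<nu> $$ (k, a') * e_nu p \<nu> (Suc a) k) *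
      (\<Sum>b'<q. (\<xi> $$ (l, b') * e_nu q \<xi> (Suc b) l) * \<mu> b' a'))"
    by (simp add: sum_product)
  also have "\<dots> = (\<Sum>l<q. \<Sum>a'<p. if a = a' then
      (\<Sum>b'<q. (\<xi> $$ (l, b') * e_nu q \<xi> (Suc b) l) * \<mu> b' a') else 0)"
    by (intro sum.cong refl) (simp add: e_nu_dual(1)[OF \<nu> a(1)])
  also have "\<dots> = (\<Sum>l<q. \<Sum>b'<q. (\<xi> $$ (l, b') * e_nu q \<xi> (Suc b) l) * \<mu> b' a)"
    using a(1) by simp
  also have "\<dots> = (\<Sum>b'<q. (\<Sum>l<q. \<xi> $$ (l, b') * e_nu q \<xi> (Suc b) l) * \<mu> b' a)"
    unfolding sum_distrib_right by (rule sum.swap)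
  also have "\<dots> = (\<Sum>b'<q. if b = b' then \<mu> b' a else 0)"
    by (intro sum.cong refl) (simp add: e_nu_dual(1)[OF \<xi> b(1)])
  also have "\<dots> = \<mu> b a" using b(1) by simp
  finally show ?thesis by (simp add: \<mu>_def X_def a b)
qed

text \<open>
  The measures are built from right limits, which form a nondecreasing right-continuous function; therefore bounded sets
  have finite measure and polynomials are integrable over them.
\<close>

lemma mono_right_limit:
  fixes F :: "real \<Rightarrow> real"
  assumes "mono F"
  shows "Lim (at_right x) F = (INF y\<in>{x<..}. F y)"
proof (intro tendsto_Lim)
  have bdd: "bdd_below (F ` {x<..})"
    using monoD[OF assms] by (intro bdd_belowI[of _ "F x"]) auto
  show "(F \<longlongrightarrow> (INF y\<in>{x<..}. F y)) (at_right x)"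
  proof (rule order_tendstoI)
    fix a assume "a < (INF y\<in>{x<..}. F y)"
    then have "a < F y" if "x < y" for y using cINF_lower[OF bdd, of y] that by simp
    then show "\<forall>\<^sub>F y in at_right x. a < F y" by (auto simp: eventually_at_right_field intro: exI[of _ "x + 1"])
  next
    fix a assume "(INF y\<in>{x<..}. F y) < a"
    then obtain z where "x < z" "F z < a" using cINF_less_iff[OF _ bdd, of a] by (auto simp: ex_gt_or_lt gt_ex)
    moreover have "F y \<le> F z" if "y < z" for y using monoD[OF assms] that by simp
    ultimately show "\<forall>\<^sub>F y in at_right x. F y < a"
      unfolding eventually_at_right_field by (meson le_less_trans)
  qed
qed simp

lemma right_limit_mono_right_continuous:
  fixes F :: "real \<Rightarrow> real"
  assumes "mono F"
  defines "G \<equiv> \<lambda>x. Lim (at_right x) F"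
  shows "x \<le> y \<Longrightarrow> G x \<le> G y" "continuous (at_right x) G"
proof -
  have G: "G x = (INF y\<in>{x<..}. F y)" for x unfolding G_def by (rule mono_right_limit[OF assms(1)])
  have bdd: "bdd_below (F ` {x<..})" for x
    using monoD[OF assms(1)] by (intro bdd_belowI[of _ "F x"]) auto
  show mono: "G x \<le> G y" if "x \<le> y" for x y
    unfolding G using that by (intro cINF_superset_mono bdd) (auto simp: gt_ex)
  show "continuous (at_right x) G"
    unfolding continuous_within
  proof (rule order_tendstoI)
    fix a assume "a < G x"
    then have "a < G y" if "x < y" for y using mono[of x y] that by simp
    then show "\<forall>\<^sub>F y in at_right x. a < G y" by (auto simp: eventually_at_right_field intro: exI[of _ "x + 1"])
  next
    fix a assume "G x < a"
    then obtain z where "x < z" "F z < a"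
      unfolding G using cINF_less_iff[OF _ bdd, of x a] by (auto simp: gt_ex)
    moreover have "G y \<le> F z" if "y < z" for y unfolding G using cINF_lower[OF bdd, of z y] that by simp
    ultimately show "\<forall>\<^sub>F y in at_right x. G y < a"
      unfolding eventually_at_right_field by (meson le_less_trans)
  qed
qed

lemma sets_stieltjes_measure: "sets (stieltjes_measure F) = sets borel"
  by (simp add: stieltjes_measure_def)

lemma emeasure_stieltjes_bounded:
  assumes "mono F" "S \<subseteq> {- C..C}" "C \<ge> 0"
  shows "emeasure (stieltjes_measure F) S < \<infinity>"
proof -
  have "emeasure (stieltjes_measure F) S \<le> emeasure (stieltjes_measure F) {- C - 1<..C}"
    using assms(2) by (intro emeasure_mono) (auto simp: sets_stieltjes_measure)
  also have "\<dots> = Lim (at_right C) F - Lim (at_right (- C - 1)) F"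
    unfolding stieltjes_measure_def
    using right_limit_mono_right_continuous[OF assms(1)] assms(3)
    by (intro emeasure_interval_measure_Ioc) auto
  also have "\<dots> < \<infinity>" by simp
  finally show ?thesis .
qed

lemma set_integrable_poly_stieltjes:
  assumes "mono F" "S \<in> sets borel" "S \<subseteq> {- C..C}" "C \<ge> 0"
  shows "set_integrable (stieltjes_measure F) S (poly P)"
proof -
  have "bounded (poly P ` {- C..C})"
    by (intro compact_imp_bounded compact_continuous_image continuous_intros) auto
  then obtain b where "\<And>x. x \<in> {- C..C} \<Longrightarrow> norm (poly P x) \<le> b"
    unfolding bounded_iff by blast
  then have "AE x in stieltjes_measure F. x \<in> S \<longrightarrow> norm (poly P x) \<le> b"
    using assms(3) by (intro AE_I2) blast
  moreover have "poly P \<in> borel_measurable (stieltjes_measure F)"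
    unfolding measurable_cong_sets[OF sets_stieltjes_measure refl]
    by (intro borel_measurable_continuous_onI continuous_intros)
  ultimately show ?thesis
    unfolding set_integrable_def
    using assms(2) emeasure_stieltjes_bounded[OF assms(1,3,4)]
    by (intro integrableI_bounded_set_indicator[where B = b]) (simp_all add: sets_stieltjes_measure)
qed

text \<open>
  The maximal absolute row sum bounds the spectrum: look at a component of largest modulus of an
  eigenvector.
\<close>

lemma eigenvalue_trunc_bounded:
  assumes T: "bounded_semi T" and x: "eigenvalue (trunc T N) x"
  shows "\<bar>x\<bar> \<le> (SUP i. \<Sum>j. \<bar>T i j\<bar>)"
proof -
  obtain v where v: "v \<in> carrier_vec (Suc N)" "v \<noteq> 0\<^sub>v (Suc N)" "trunc T N *\<^sub>v v = x \<cdot>\<^sub>v v"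
    using x by (auto simp: eigenvalue_def eigenvector_def trunc_def)
  define m where "m = Max ((\<lambda>i. \<bar>v $ i\<bar>) ` {..<Suc N})"
  have m: "\<bar>v $ i\<bar> \<le> m" if "i < Suc N" for i unfolding m_def using that by (intro Max_ge) auto
  have "m \<in> (\<lambda>i. \<bar>v $ i\<bar>) ` {..<Suc N}" unfolding m_def by (intro Max_in) auto
  then obtain i where i: "i < Suc N" "m = \<bar>v $ i\<bar>" by auto
  have "m > 0"
  proof (rule ccontr)
    assume "\<not> ?thesis"
    then have "v $ j = 0" if "j < Suc N" for j using m[OF that] by linarith
    then show False using v(1,2) by (auto simp: vec_eq_iff)
  qed
  have "x * v $ i = (\<Sum>j<Suc N. T i j * v $ j)"
    using arg_cong[OF v(3), of "\<lambda>u. u $ i"] i(1) v(1)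
    by (simp add: trunc_def scalar_prod_def atLeast0LessThan)
  moreover have "\<bar>x\<bar> * m = \<bar>x * v $ i\<bar>" unfolding abs_mult i(2) ..
  ultimately have "\<bar>x\<bar> * m = \<bar>\<Sum>j<Suc N. T i j * v $ j\<bar>" by (simp only:)
  also have "\<dots> \<le> (\<Sum>j<Suc N. \<bar>T i j\<bar> * m)"
    by (rule order.trans[OF sum_abs]) (intro sum_mono, auto simp: abs_mult intro!: mult_left_mono m)
  also have "\<dots> = (\<Sum>j<Suc N. \<bar>T i j\<bar>) * m" by (simp only: sum_distrib_right)
  also have "\<dots> \<le> (\<Sum>j. \<bar>T i j\<bar>) * m"
    using T \<open>m > 0\<close> by (intro mult_right_mono sum_le_suminf) (auto simp: bounded_semi_def)
  also have "\<dots> \<le> (SUP i. \<Sum>j. \<bar>T i j\<bar>) * m"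
    using T \<open>m > 0\<close> by (intro mult_right_mono cSUP_upper) (auto simp: bounded_semi_def)
  finally show ?thesis using \<open>m > 0\<close> by simp
qed

lemma Delta_bounded:
  assumes "bounded_semi T"
  shows "\<exists>C\<ge>0. Delta T \<subseteq> {- C..C}"
proof -
  let ?C = "\<bar>SUP i. \<Sum>j. \<bar>T i j\<bar>\<bar>"
  have "x \<in> {- ?C..?C}" if "eigenvalue (trunc T N) x" for N x
    using eigenvalue_trunc_bounded[OF assms that] by (auto simp: abs_le_iff)
  then have "Delta T \<subseteq> {- ?C..?C}"
    unfolding Delta_def by (intro Inter_lower) (auto simp: is_interval_cc)
  then show ?thesis by (intro exI[of _ ?C]) simp
qed

lemma moments_eq_form:
  assumes T: "banded p q T" "bounded_semi T"
    and \<nu>: "lower_unitriangular p \<nu>" and \<xi>: "lower_unitriangular q \<xi>"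
    and A: "recursion_A p q T \<nu> A" and B: "recursion_B p q T \<xi> B"
    and \<psi>: "\<And>a b. a \<in> {1..p} \<Longrightarrow> b \<in> {1..q} \<Longrightarrow> mono (\<psi> b a)"
    and biorth: "\<And>k l. (\<Sum>a = 1..p. \<Sum>b = 1..q.
             LINT x:Delta T|stieltjes_measure (\<psi> b a). poly (B b l) x * poly (A a k) x) =
           (if k = l then 1 else 0)"
    and ab: "a \<in> {1..p}" "b \<in> {1..q}"
  shows "(LINT x:Delta T|stieltjes_measure (\<psi> b a). x ^ n) =
    semi_form (e_xi q \<xi> b) (semi_pow T n) (e_nu p \<nu> a)"
proof -
  obtain C where C: "C \<ge> 0" "Delta T \<subseteq> {- C..C}" using Delta_bounded[OF T(2)] by blast
  have "closed (Delta T)" unfolding Delta_def by (intro closed_Inter) auto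
  then have borel: "Delta T \<in> sets borel" by simp
  define \<phi> where "\<phi> = (\<lambda>b a P. LINT x:Delta T|stieltjes_measure (\<psi> b a). poly P x)"
  note int = set_integrable_poly_stieltjes[OF \<psi> borel C(2,1)]
  have "\<phi> b a ([:0, 1:] ^ n) = semi_form (e_xi q \<xi> b) (semi_pow T n) (e_nu p \<nu> a)"
  proof (rule moments_from_biorthogonality[OF T(1) \<nu> \<xi> A B _ _ _ ab])
    show "(\<Sum>a = 1..p. \<Sum>b = 1..q. \<phi> b a (B b l * A a k)) = (if k = l then 1 else 0)" for k l
      unfolding \<phi>_def poly_mult by (rule biorth)
    fix a b c and P Q :: "real poly" assume "a \<in> {1..p}" "b \<in> {1..q}"
    note int = int[OF this]
    have "poly (P + Q) = (\<lambda>x. poly P x + poly Q x)" by auto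
    then show "\<phi> b a (P + Q) = \<phi> b a P + \<phi> b a Q"
      unfolding \<phi>_def using set_integral_add(2)[OF int int] by simp
    have "poly (Polynomial.smult c P) = (\<lambda>x. c * poly P x)" by auto
    then show "\<phi> b a (Polynomial.smult c P) = c * \<phi> b a P"
      unfolding \<phi>_def by simp
  qed
  moreover have "poly ([:0, 1:] ^ n) = (\<lambda>x :: real. x ^ n)" by (simp add: fun_eq_iff poly_power)
  ultimately show ?thesis by (simp add: \<phi>_def)
qed

section \<open>Paths that leave the truncation\<close>

definition trunc_pow :: "nat \<Rightarrow> semi_mat \<Rightarrow> nat \<Rightarrow> semi_mat" where
  "trunc_pow n T m = (trunc_mult n T ^^ m) semi_id"

lemma trunc_pow_0: "trunc_pow n T 0 = semi_id"
  and trunc_pow_Suc: "trunc_pow n T (Suc m) = trunc_mult n T (trunc_pow n T m)"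
  by (simp_all add: trunc_pow_def)

lemma trunc_app_pow: "i < n \<Longrightarrow> (trunc_app n T ^^ m) f i = trunc_app n (trunc_pow n T m) f i"
proof (induction m arbitrary: i)
  case 0
  then show ?case
    by (simp add: trunc_pow_0 trunc_app_def semi_id_def if_distrib[of "\<lambda>t. t * _"] cong: if_cong)
next
  case (Suc m)
  then show ?case by (auto simp: trunc_pow_Suc trunc_app_mult intro!: trunc_app_cong)
qed

lemma trunc_power_entry:
  assumes "i < Suc N"
  shows "((trunc T N ^\<^sub>m m) *\<^sub>v vec (N + 1) f) $ i = (trunc_app (Suc N) T ^^ m) f i"
  using assms
proof (induction m arbitrary: f i)
  case 0
  then show ?case by (simp add: trunc_def)
next
  case (Suc m)
  have c: "trunc T N \<in> carrier_mat (Suc N) (Suc N)" by (simp add: trunc_def)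
  have "trunc T N *\<^sub>v vec (N + 1) f = vec (N + 1) (trunc_app (Suc N) T f)"
    by (intro eq_vecI) (auto simp: trunc_def trunc_app_def scalar_prod_def atLeast0LessThan)
  then have "(trunc T N ^\<^sub>m Suc m) *\<^sub>v vec (N + 1) f =
      (trunc T N ^\<^sub>m m) *\<^sub>v vec (N + 1) (trunc_app (Suc N) T f)"
    using c by (simp add: assoc_mult_mat_vec[of _ "Suc N" "Suc N" _ "Suc N"] pow_carrier_mat)
  then show ?case using Suc by (simp add: funpow_swap1)
qed

text \<open>
  The total weight of the paths with \<open>m\<close> steps from \<open>i\<close> to \<open>j\<close> that visit an index above \<open>N\<close>, if \<open>i\<close>
  and \<open>j\<close> are at most \<open>N\<close>.
\<close>

definition excess :: "nat \<Rightarrow> semi_mat \<Rightarrow> nat \<Rightarrow> semi_mat" where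
  "excess N T m i j = semi_pow T m i j - trunc_pow (Suc N) T m i j"

lemma semi_pow_nonneg:
  assumes T: "banded p q T" and "\<And>i j. T i j \<ge> 0"
  shows "semi_pow T m i j \<ge> 0"
proof (induction m arbitrary: i)
  case 0
  then show ?case by (simp add: semi_pow_0 semi_id_def)
next
  case (Suc m)
  then show ?case using assms by (auto simp: semi_pow_Suc semi_mult_banded[OF T] intro!: sum_nonneg)
qed

text \<open>
  Split by the first step: either it stays within the truncation and the path leaves later, or it
  leaves at once and the rest is arbitrary.
\<close>

lemma excess_Suc:
  assumes T: "banded p q T"
  shows "excess N T (Suc m) i j = (\<Sum>l<Suc N. T i l * excess N T m l j) +
    (\<Sum>l = Suc N..<Suc N + i + q. T i l * semi_pow T m l j)"
proof -
  have T0: "T i l = 0" if "l > i + q" for l using T that by (simp add: banded_def)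
  have "semi_mult T (semi_pow T m) i j = (\<Sum>l<Suc N + i + q. T i l * semi_pow T m l j)"
    unfolding semi_mult_def using T0 by (intro suminf_finite) auto
  also have "\<dots> = (\<Sum>l\<in>{..<Suc N} \<union> {Suc N..<Suc N + i + q}. T i l * semi_pow T m l j)"
    by (intro sum.cong) auto
  also have "\<dots> = (\<Sum>l<Suc N. T i l * semi_pow T m l j) +
      (\<Sum>l = Suc N..<Suc N + i + q. T i l * semi_pow T m l j)"
    by (intro sum.union_disjoint) auto
  finally show ?thesis
    by (simp add: excess_def semi_pow_Suc trunc_pow_Suc trunc_mult_def right_diff_distrib sum_subtractf del: sum.lessThan_Suc)
qed

context
  fixes p q :: nat and T :: semi_mat
  assumes T: "banded p q T" and nonneg: "\<And>i j. T i j \<ge> 0"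
    and diag: "\<And>i. T i i > 0" and super: "\<And>i. T i (Suc i) > 0" and sub: "\<And>i. T (Suc i) i > 0"
begin

lemma excess_nonneg: "excess N T m i j \<ge> 0"
proof (induction m arbitrary: i)
  case 0
  then show ?case by (simp add: excess_def semi_pow_0 trunc_pow_0)
next
  case (Suc m)
  then show ?case unfolding excess_Suc[OF T] using nonneg semi_pow_nonneg[OF T nonneg]
    by (intro add_nonneg_nonneg sum_nonneg mult_nonneg_nonneg) auto
qed

lemma excess_step:
  assumes "l < Suc N"
  shows "excess N T (Suc m) i j \<ge> T i l * excess N T m l j"
proof -
  have "T i l * excess N T m l j \<le> (\<Sum>l<Suc N. T i l * excess N T m l j)"
    using assms nonneg excess_nonneg by (intro member_le_sum) auto
  moreover have "(\<Sum>l = Suc N..<Suc N + i + q. T i l * semi_pow T m l j) \<ge> 0"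
    using nonneg semi_pow_nonneg[OF T nonneg] by (intro sum_nonneg) auto
  ultimately show ?thesis unfolding excess_Suc[OF T] by linarith
qed

lemma excess_persists: "i < Suc N \<Longrightarrow> excess N T m i j > 0 \<Longrightarrow> excess N T (Suc m) i j > 0"
  using excess_step[of i N i m j] diag[of i] by (smt (verit) mult_pos_pos)

lemma semi_pow_path: "semi_pow T i i 0 > 0"
proof (induction i)
  case 0
  then show ?case by (simp add: semi_pow_0 semi_id_def)
next
  case (Suc i)
  have band: "Suc i - p \<le> i"
  proof -
    have "\<not> Suc i > i + p"
    proof
      assume "Suc i > i + p"
      then have "T (Suc i) i = 0" using T unfolding banded_def by blast
      then show False using sub[of i] by simp
    qed
    then show ?thesis by simp
  qed
  have "0 < T (Suc i) i * semi_pow T i i 0" using Suc sub by simp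
  also have "\<dots> \<le> (\<Sum>l = Suc i - p..Suc i + q. T (Suc i) l * semi_pow T i l 0)"
    using band nonneg semi_pow_nonneg[OF T nonneg] by (intro member_le_sum) auto
  finally show ?case by (simp add: semi_pow_Suc semi_mult_banded[OF T])
qed

text \<open>
  Go from \<open>0\<close> up to \<open>N + 1\<close> along the superdiagonal and back along the subdiagonal.
\<close>

lemma excess_exists: "\<exists>m. excess N T m 0 0 > 0"
proof -
  have q: "q \<ge> 1"
  proof (rule ccontr)
    assume "\<not> q \<ge> 1"
    then have "T 0 (Suc 0) = 0" using T unfolding banded_def by simp
    then show False using super[of 0] by simp
  qed
  have "excess N T (Suc (Suc N) + k) (N - k) 0 > 0" if "k \<le> N" for k
    using that
  proof (induction k)
    case 0
    have "0 < T N (Suc N) * semi_pow T (Suc N) (Suc N) 0" using super semi_pow_path by simp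
    also have "\<dots> \<le> (\<Sum>l = Suc N..<Suc N + N + q. T N l * semi_pow T (Suc N) l 0)"
      using q nonneg semi_pow_nonneg[OF T nonneg] by (intro member_le_sum) auto
    also have "\<dots> \<le> excess N T (Suc (Suc N)) N 0"
      unfolding excess_Suc[OF T, of N "Suc N"] using nonneg excess_nonneg
      by (simp add: sum_nonneg del: sum.lessThan_Suc)
    finally show ?case by simp
  next
    case (Suc k)
    then have k: "N - k = Suc (N - Suc k)" by simp
    have "0 < T (N - Suc k) (N - k) * excess N T (Suc (Suc N) + k) (N - k) 0"
      unfolding k using super Suc k by simp
    also have "\<dots> \<le> excess N T (Suc (Suc (Suc N) + k)) (N - Suc k) 0" by (rule excess_step) simp
    finally show ?case by simp
  qed
  from this[of N] show ?thesis by auto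
qed

text \<open>
  The gap is a combination of excesses with nonnegative coefficients, so it inherits from them that it
  is nonnegative, that it stays positive once it is, and, as \<open>u 0\<close> and \<open>v 0\<close> are positive, that it
  becomes positive. Hence the set of \<open>d\<close> up to which the gap vanishes is bounded, its greatest element
  exists, and the gap is positive from the next index on.
\<close>

lemma precision_degree_dichotomy:
  assumes u: "\<And>i. u i \<ge> 0" "u 0 > 0" "\<And>i. i \<ge> Suc N \<Longrightarrow> u i = 0"
    and v: "\<And>i. v i \<ge> 0" "v 0 > 0" "\<And>i. i \<ge> Suc N \<Longrightarrow> v i = 0"
    and gap_def: "gap = (\<lambda>m. semi_form u (semi_pow T m) v - (\<Sum>i<Suc N. u i * (trunc_app (Suc N) T ^^ m) v i))"
    and d_def: "d = (GREATEST d. \<forall>m\<le>d. gap m = 0)"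
  shows "m \<le> d \<Longrightarrow> gap m = 0" "m > d \<Longrightarrow> gap m > 0"
proof -
  have gap: "gap m = (\<Sum>i<Suc N. \<Sum>j<Suc N. u i * excess N T m i j * v j)" for m
  proof -
    have "(\<Sum>i<Suc N. u i * (trunc_app (Suc N) T ^^ m) v i) =
        (\<Sum>i<Suc N. \<Sum>j<Suc N. u i * trunc_pow (Suc N) T m i j * v j)"
      by (intro sum.cong refl) (simp add: trunc_app_pow trunc_app_def sum_distrib_left mult.assoc del: sum.lessThan_Suc)
    moreover have "semi_form u (semi_pow T m) v = (\<Sum>i<Suc N. \<Sum>j<Suc N. u i * semi_pow T m i j * v j)"
      using u v by (intro semi_form_finite_support) auto
    moreover have "u i * excess N T m i j * v j =
        u i * semi_pow T m i j * v j - u i * trunc_pow (Suc N) T m i j * v j" for i j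
      by (simp add: excess_def algebra_simps)
    ultimately show ?thesis by (simp only: gap_def sum_subtractf)
  qed
  have term0: "u i * excess N T m i j * v j \<ge> 0" for m i j using u v excess_nonneg by simp
  have gap_ge: "gap m \<ge> u i * excess N T m i j * v j" if "i < Suc N" "j < Suc N" for m i j
  proof -
    have "u i * excess N T m i j * v j \<le> (\<Sum>j<Suc N. u i * excess N T m i j * v j)"
      using that term0 by (intro member_le_sum) auto
    also have "\<dots> \<le> gap m"
      unfolding gap using that term0 by (intro member_le_sum[of i]) (auto intro: sum_nonneg simp del: sum.lessThan_Suc)
    finally show ?thesis .
  qed
  have gap_nonneg: "gap m \<ge> 0" for m unfolding gap using term0 by (intro sum_nonneg) auto
  have persists: "gap (Suc m) > 0" if m: "gap m > 0" for m
  proof -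
    have "\<exists>i<Suc N. \<exists>j<Suc N. u i * excess N T m i j * v j \<noteq> 0"
    proof (rule ccontr)
      assume "\<not> ?thesis"
      then have "u i * excess N T m i j * v j = 0" if "i < Suc N" "j < Suc N" for i j
        using that by blast
      then have "gap m = 0" unfolding gap by (intro sum.neutral ballI) (simp only: lessThan_iff)
      then show False using m by simp
    qed
    then obtain i j where ij: "i < Suc N" "j < Suc N" "u i * excess N T m i j * v j \<noteq> 0" by blast
    then have "u i > 0" "excess N T m i j > 0" "v j > 0"
      using u(1)[of i] v(1)[of j] excess_nonneg[of N m i j] by (auto simp: less_le)
    then have "u i * excess N T (Suc m) i j * v j > 0"
      using excess_persists[OF ij(1)] by simp
    then show ?thesis using gap_ge[OF ij(1,2), of "Suc m"] by linarith
  qed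
  have persists': "gap m > 0 \<Longrightarrow> gap (m + k) > 0" for m k
    by (induction k) (auto intro: persists)
  obtain m0 where "excess N T m0 0 0 > 0" using excess_exists by blast
  then have "0 < u 0 * excess N T m0 0 0 * v 0" using u(2) v(2) by simp
  also have "\<dots> \<le> gap m0" by (rule gap_ge) simp_all
  finally have "gap m0 > 0" .
  have bound: "e \<le> m0" if "\<forall>m\<le>e. gap m = 0" for e
  proof (rule ccontr)
    assume "\<not> e \<le> m0"
    then have "gap m0 = 0" using that by simp
    then show False using \<open>gap m0 > 0\<close> by simp
  qed
  have gap0: "\<forall>m\<le>0. gap m = 0"
    by (simp add: gap excess_def semi_pow_0 trunc_pow_0 del: sum.lessThan_Suc)
  have zero: "\<forall>m\<le>d. gap m = 0"
    unfolding d_def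
    by (rule GreatestI_nat[where P = "\<lambda>d. \<forall>m\<le>d. gap m = 0" and k = 0 and b = m0, OF gap0 bound])
  then show "gap m = 0" if "m \<le> d" using that by blast
  have "\<not> (\<forall>m\<le>Suc d. gap m = 0)"
  proof
    assume "\<forall>m\<le>Suc d. gap m = 0"
    from Greatest_le_nat[where P = "\<lambda>d. \<forall>m\<le>d. gap m = 0" and b = m0, OF this bound]
    have "Suc d \<le> d" unfolding d_def .
    then show False by simp
  qed
  then have "gap (Suc d) \<noteq> 0" using zero le_Suc_eq by metis
  then have pos: "gap (Suc d) > 0" using gap_nonneg[of "Suc d"] by simp
  show "gap m > 0" if "m > d" using persists'[OF pos, of "m - Suc d"] that by simp
qed

end

section \<open>Positivity of the initial conditions\<close>

lemma mult_mat_nonneg_pos: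
  fixes X Y :: "real mat"
  assumes XY: "X \<in> carrier_mat n n" "Y \<in> carrier_mat n n" and nn: "nonneg_mat X" "nonneg_mat Y"
    and ij: "i < n" "j < n"
  shows "(X * Y) $$ (i, j) \<ge> 0"
    and "k < n \<Longrightarrow> X $$ (i, k) > 0 \<Longrightarrow> Y $$ (k, j) > 0 \<Longrightarrow> (X * Y) $$ (i, j) > 0"
proof -
  have eq: "(X * Y) $$ (i, j) = (\<Sum>k<n. X $$ (i, k) * Y $$ (k, j))"
    using XY ij by (simp add: scalar_prod_def atLeast0LessThan)
  have t: "X $$ (i, l) * Y $$ (l, j) \<ge> 0" if "l < n" for l
  proof -
    have "X $$ (i, l) \<ge> 0" "Y $$ (l, j) \<ge> 0"
      using nn XY ij that unfolding nonneg_mat_def by (simp_all add: carrier_matD)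
    then show ?thesis by (rule mult_nonneg_nonneg)
  qed
  show "(X * Y) $$ (i, j) \<ge> 0"
    unfolding eq by (rule sum_nonneg) (simp only: lessThan_iff t)
  show "(X * Y) $$ (i, j) > 0" if "k < n" "X $$ (i, k) > 0" "Y $$ (k, j) > 0"
    unfolding eq
  proof (rule sum_pos2[where i = k])
    show "0 < X $$ (i, k) * Y $$ (k, j)" using that(2,3) by (rule mult_pos_pos)
  qed (use that(1) t in simp_all)
qed

lemma mat_prod_nonneg:
  assumes n: "n \<ge> 1"
    and Ms: "\<And>M. M \<in> set Ms \<Longrightarrow> M \<in> carrier_mat n n \<and> nonneg_mat M \<and> M $$ (0, 0) > 0"
  shows "mat_prod n Ms \<in> carrier_mat n n \<and> nonneg_mat (mat_prod n Ms) \<and> mat_prod n Ms $$ (0, 0) > 0"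
  using Ms
proof (induction Ms)
  case Nil
  then show ?case using n by (simp add: mat_prod_def nonneg_mat_def)
next
  case (Cons M Ms)
  let ?P = "mat_prod n Ms"
  have P: "?P \<in> carrier_mat n n" "nonneg_mat ?P" "?P $$ (0, 0) > 0"
    using Cons.IH Cons.prems by (metis list.set_intros(2))+
  have M: "M \<in> carrier_mat n n" "nonneg_mat M" "M $$ (0, 0) > 0"
    using Cons.prems by (metis list.set_intros(1))+
  have eq: "mat_prod n (M # Ms) = M * ?P" by (simp add: mat_prod_def)
  have MP: "M * ?P \<in> carrier_mat n n" using M(1) P(1) by (rule mult_carrier_mat)
  have "nonneg_mat (M * ?P)"
    unfolding nonneg_mat_def carrier_matD[OF MP]
    using mult_mat_nonneg_pos(1)[OF M(1) P(1) M(2) P(2)] by blast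
  moreover have "(M * ?P) $$ (0, 0) > 0"
    using n by (intro mult_mat_nonneg_pos(2)[OF M(1) P(1) M(2) P(2) _ _ _ M(3) P(3)]) simp_all
  ultimately show ?case using MP unfolding eq by blast
qed

lemma Lambda_mat_nonneg:
  assumes p: "p \<ge> 1" and L: "\<And>k i. k \<in> {1..p} \<Longrightarrow> L k i > 0"
  shows "Lambda_mat p L \<in> carrier_mat p p" "nonneg_mat (Lambda_mat p L)"
    "a < p \<Longrightarrow> Lambda_mat p L $$ (0, a) > 0"
proof -
  let ?M = "\<lambda>a. mat_prod p (map (\<lambda>j. trunc (lower_bidiag (L j)) (p - 1)) [1..<Suc a])"
  show c: "Lambda_mat p L \<in> carrier_mat p p" unfolding Lambda_mat_def using p by (simp add: mat_of_cols_def)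
  have M: "?M a \<in> carrier_mat p p" "nonneg_mat (?M a)" "?M a $$ (0, 0) > 0" if "a < p" for a
  proof -
    have "M \<in> carrier_mat p p \<and> nonneg_mat M \<and> M $$ (0, 0) > 0"
      if M: "M \<in> set (map (\<lambda>j. trunc (lower_bidiag (L j)) (p - 1)) [1..<Suc a])" for M
    proof -
      obtain j where "j \<in> set [1..<Suc a]" and eq: "M = trunc (lower_bidiag (L j)) (p - 1)"
        using M by (auto simp del: upt_Suc)
      then have j: "j \<in> {1..p}" using \<open>a < p\<close> by (simp del: upt_Suc)
      then show ?thesis
        unfolding eq using p L[OF j] by (auto simp: trunc_def nonneg_mat_def lower_bidiag_def less_imp_le)
    qed
    from mat_prod_nonneg[OF p this]
    show "?M a \<in> carrier_mat p p" "nonneg_mat (?M a)" "?M a $$ (0, 0) > 0" by blast+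
  qed
  have r: "(\<Prod>j = 1..<Suc a. L j (Suc a - 1 - j)) > 0" if "a < p" for a
    using that L by (intro prod_pos) auto
  have e: "Lambda_mat p L $$ (i, a) = 1 / (\<Prod>j = 1..<Suc a. L j (Suc a - 1 - j)) * ?M a $$ (i, 0)"
    if "i < p" "a < p" for i a
  proof -
    have "[1..<p + 1] ! a = Suc a" using that by (subst nth_upt) auto
    then show ?thesis
      unfolding Lambda_mat_def using that M(1)[OF that(2)] p
      by (subst mat_of_cols_index) (simp_all del: upt_Suc)
  qed
  show "nonneg_mat (Lambda_mat p L)"
    unfolding nonneg_mat_def
  proof (intro allI impI)
    fix i j assume "i < dim_row (Lambda_mat p L)" "j < dim_col (Lambda_mat p L)"
    then have ij: "i < p" "j < p" using c by auto
    have "?M j $$ (i, 0) \<ge> 0" using M(1,2)[OF ij(2)] ij by (auto simp: nonneg_mat_def)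
    then show "Lambda_mat p L $$ (i, j) \<ge> 0"
      unfolding e[OF ij] using r[OF ij(2)] by (intro mult_nonneg_nonneg) (auto intro: less_imp_le)
  qed
  show "Lambda_mat p L $$ (0, a) > 0" if "a < p"
    using e[of 0 a] M(3)[OF that] r[OF that] that by simp
qed

lemma Upsilon_mat_nonneg:
  assumes q: "q \<ge> 1" and U: "\<And>k i. k \<in> {1..q} \<Longrightarrow> U k i > 0"
  shows "Upsilon_mat q U \<in> carrier_mat q q" "nonneg_mat (Upsilon_mat q U)"
    "a < q \<Longrightarrow> Upsilon_mat q U $$ (a, 0) > 0"
proof -
  let ?M = "\<lambda>a. mat_prod q (map (\<lambda>j. trunc (upper_bidiag (U j)) (q - 1)) (rev [1..<Suc a]))"
  show c: "Upsilon_mat q U \<in> carrier_mat q q" unfolding Upsilon_mat_def using q by (simp add: mat_of_rows_def)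
  have M: "?M a \<in> carrier_mat q q" "nonneg_mat (?M a)" "?M a $$ (0, 0) > 0" if "a < q" for a
  proof -
    have "M \<in> carrier_mat q q \<and> nonneg_mat M \<and> M $$ (0, 0) > 0"
      if M: "M \<in> set (map (\<lambda>j. trunc (upper_bidiag (U j)) (q - 1)) (rev [1..<Suc a]))" for M
    proof -
      obtain j where "j \<in> set [1..<Suc a]" and eq: "M = trunc (upper_bidiag (U j)) (q - 1)"
        using M by (auto simp del: upt_Suc)
      then have j: "j \<in> {1..q}" using \<open>a < q\<close> by (simp del: upt_Suc)
      then show ?thesis
        unfolding eq using q U[OF j] by (auto simp: trunc_def nonneg_mat_def upper_bidiag_def less_imp_le)
    qed
    from mat_prod_nonneg[OF q this]
    show "?M a \<in> carrier_mat q q" "nonneg_mat (?M a)" "?M a $$ (0, 0) > 0" by blast+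
  qed
  have r: "(\<Prod>j = 1..<Suc a. U j (Suc a - 1 - j)) > 0" if "a < q" for a
    using that U by (intro prod_pos) auto
  have e: "Upsilon_mat q U $$ (a, i) = 1 / (\<Prod>j = 1..<Suc a. U j (Suc a - 1 - j)) * ?M a $$ (0, i)"
    if "i < q" "a < q" for i a
  proof -
    have "[1..<q + 1] ! a = Suc a" using that by (subst nth_upt) auto
    then show ?thesis
      unfolding Upsilon_mat_def using that M(1)[OF that(2)] q
      by (subst mat_of_rows_index) (simp_all del: upt_Suc)
  qed
  show "nonneg_mat (Upsilon_mat q U)"
    unfolding nonneg_mat_def
  proof (intro allI impI)
    fix i j assume "i < dim_row (Upsilon_mat q U)" "j < dim_col (Upsilon_mat q U)"
    then have ij: "i < q" "j < q" using c by auto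
    have "?M i $$ (0, j) \<ge> 0" using M(1,2)[OF ij(1)] ij by (auto simp: nonneg_mat_def)
    then show "Upsilon_mat q U $$ (i, j) \<ge> 0"
      unfolding e[OF ij(2,1)] using r[OF ij(1)] by (intro mult_nonneg_nonneg) (auto intro: less_imp_le)
  qed
  show "Upsilon_mat q U $$ (a, 0) > 0" if "a < q"
    using e[of 0 a] M(3)[OF that] r[OF that] that by simp
qed

lemma semi_form_trunc:
  "scalar_prod (vec (N + 1) u) ((trunc T N ^\<^sub>m m) *\<^sub>v vec (N + 1) v) =
     (\<Sum>i<Suc N. u i * (trunc_app (Suc N) T ^^ m) v i)"
proof -
  have "trunc T N ^\<^sub>m m \<in> carrier_mat (Suc N) (Suc N)"
    by (intro pow_carrier_mat) (simp add: trunc_def)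
  then have "dim_vec ((trunc T N ^\<^sub>m m) *\<^sub>v vec (N + 1) v) = Suc N"
    unfolding dim_mult_mat_vec by (rule carrier_matD)
  then show ?thesis
    unfolding scalar_prod_def atLeast0LessThan
    by (intro sum.cong) (simp_all add: trunc_power_entry[unfolded Suc_eq_plus1[symmetric]] del: index_mult_mat_vec)
qed

lemma e_nu_nonneg:
  assumes p: "p \<ge> 1" and L: "\<And>k i. k \<in> {1..p} \<Longrightarrow> L k i > 0"
    and \<A>: "upper_unitriangular p \<A>" "nonneg_mat \<A>"
    and eq: "mat_inv (transpose_mat \<nu>) = Lambda_mat p L * \<A>" and a: "a \<in> {1..p}"
  shows "e_nu p \<nu> a i \<ge> 0" "e_nu p \<nu> a 0 > 0"
proof -
  have c: "\<A> \<in> carrier_mat p p" and d: "\<A> $$ (a - 1, a - 1) > 0" and a': "a - 1 < p"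
    using \<A> a by (auto simp: upper_unitriangular_def)
  note L' = Lambda_mat_nonneg[where L = L, OF p L]
  show "e_nu p \<nu> a i \<ge> 0"
    using mult_mat_nonneg_pos(1)[OF L'(1) c L'(2) \<A>(2), of i "a - 1"] a' by (simp add: e_nu_def eq)
  show "e_nu p \<nu> a 0 > 0"
    using mult_mat_nonneg_pos(2)[OF L'(1) c L'(2) \<A>(2), of 0 "a - 1" "a - 1"] a' d L'(3)[OF _ a'] p
    by (simp add: e_nu_def eq)
qed

lemma e_xi_nonneg:
  assumes q: "q \<ge> 1" and U: "\<And>k i. k \<in> {1..q} \<Longrightarrow> U k i > 0"
    and \<B>: "lower_unitriangular q \<B>" "nonneg_mat \<B>"
    and eq: "mat_inv \<xi> = \<B> * Upsilon_mat q U" and b: "b \<in> {1..q}"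
  shows "e_xi q \<xi> b i \<ge> 0" "e_xi q \<xi> b 0 > 0"
proof -
  have b': "b - 1 < q" using b by auto
  have c: "\<B> \<in> carrier_mat q q" using \<B>(1) by (auto simp: lower_unitriangular_def upper_unitriangular_def)
  have "transpose_mat \<B> $$ (b - 1, b - 1) = 1"
    using \<B>(1) b' by (simp add: lower_unitriangular_def upper_unitriangular_def)
  then have d: "\<B> $$ (b - 1, b - 1) > 0" using c b' by simp
  note U' = Upsilon_mat_nonneg[where U = U, OF q U]
  show "e_xi q \<xi> b i \<ge> 0"
    using mult_mat_nonneg_pos(1)[OF c U'(1) \<B>(2) U'(2), of "b - 1" i] b' by (simp add: e_xi_def eq)
  show "e_xi q \<xi> b 0 > 0"
    using mult_mat_nonneg_pos(2)[OF c U'(1) \<B>(2) U'(2), of "b - 1" 0 "b - 1"] b' d U'(3)[OF _ b'] q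
    by (simp add: e_xi_def eq)
qed

section \<open>Degrees of precision of the quadrature\<close>

theorem theorem10p3:
  fixes p q N :: nat
    and T :: "nat \<Rightarrow> nat \<Rightarrow> real"
    and L U :: "nat \<Rightarrow> nat \<Rightarrow> real" and D :: "nat \<Rightarrow> real"
    and \<nu> \<xi> \<A> \<B> :: "real mat"
    and A B :: "nat \<Rightarrow> nat \<Rightarrow> real poly"
    and \<psi> :: "nat \<Rightarrow> nat \<Rightarrow> real \<Rightarrow> real"
  assumes "p \<ge> 1" and "q \<ge> 1"
    and "banded p q T" and "bounded_semi T" and "is_PBF p q T L D U"
    and "lower_unitriangular p \<nu>" and "lower_unitriangular q \<xi>"
    and "upper_unitriangular p \<A>" and "nonneg_mat \<A>"
    and "lower_unitriangular q \<B>" and "nonneg_mat \<B>"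
    and "mat_inv (transpose_mat \<nu>) = Lambda_mat p L * \<A>"
    and "mat_inv \<xi> = \<B> * Upsilon_mat q U"
    and "recursion_A p q T \<nu> A" and "recursion_B p q T \<xi> B"
    and "\<And>a b. a \<in> {1..p} \<Longrightarrow> b \<in> {1..q} \<Longrightarrow> mono (\<psi> b a)"
    and "\<And>a b. a \<in> {1..p} \<Longrightarrow> b \<in> {1..q} \<Longrightarrow>
           measure_supported_on (stieltjes_measure (\<psi> b a)) (Delta T)"
    and "\<And>k l. (\<Sum>a = 1..p. \<Sum>b = 1..q.
             LINT x:Delta T|stieltjes_measure (\<psi> b a). poly (B b l) x * poly (A a k) x) =
           (if k = l then 1 else 0)"
    and "N \<ge> max p q"
  shows "\<forall>a\<in>{1..p}. \<forall>b\<in>{1..q}.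
     (\<forall>n \<le> precision_degree p q T \<nu> \<xi> b a N.
        (LINT x:Delta T|stieltjes_measure (\<psi> b a). x ^ n) =
        (\<Sum>k = 1..N + 1. christoffel_rho q T B N k b * christoffel_mu p q T A B N k a *
           zero_of T N k ^ n)) \<and>
     (\<forall>n > precision_degree p q T \<nu> \<xi> b a N.
        (LINT x:Delta T|stieltjes_measure (\<psi> b a). x ^ n) -
        (\<Sum>k = 1..N + 1. christoffel_rho q T B N k b * christoffel_mu p q T A B N k a *
           zero_of T N k ^ n) > 0)"
proof (intro ballI)
  fix a b assume ab: "a \<in> {1..p}" "b \<in> {1..q}"
  note pq = assms(1,2) and T = assms(3) and PBF = assms(5)
  have N: "p \<le> N" "q \<le> N" using assms(19) by auto
  note bid = PBF_bidiag_prod[OF pq PBF]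
  have conn: "connected_kernel n T" for n using bidiag_prod_connected[OF bid] .
  have nonneg: "T i j \<ge> 0" for i j
    using conn[of "Suc (max i j)"] unfolding connected_kernel_def
    by (meson le_imp_less_Suc max.cobounded1 max.cobounded2)
  have near: "T i i > 0" "T i (Suc i) > 0" "T (Suc i) i > 0" for i
    using conn[of "Suc (Suc i)"] unfolding connected_kernel_def by simp_all
  let ?u = "e_xi q \<xi> b" and ?v = "e_nu p \<nu> a"
  let ?I = "\<lambda>n. LINT x:Delta T|stieltjes_measure (\<psi> b a). x ^ n"
  let ?S = "\<lambda>n. \<Sum>k = 1..N + 1. christoffel_rho q T B N k b * christoffel_mu p q T A B N k a *
           zero_of T N k ^ n"
  define gap where "gap = (\<lambda>n. semi_form ?u (semi_pow T n) ?v -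
    (\<Sum>i<Suc N. ?u i * (trunc_app (Suc N) T ^^ n) ?v i))"
  have gap: "?I n - ?S n = gap n" for n
    unfolding gap_def
    using moments_eq_form[OF T assms(4,6,7,14,15,16,18) ab]
      christoffel_quadrature[OF pq N T bid assms(6,7,14,15) ab] by simp
  have pd: "precision_degree p q T \<nu> \<xi> b a N = (GREATEST d. \<forall>n\<le>d. gap n = 0)"
    unfolding precision_degree_def semi_form_trunc gap_def right_minus_eq ..
  have Lpos: "L k i > 0" if "k \<in> {1..p}" for k i using PBF that unfolding is_PBF_def by blast
  have Upos: "U k i > 0" if "k \<in> {1..q}" for k i using PBF that unfolding is_PBF_def by blast
  have u: "?u i \<ge> 0" "?u 0 > 0" for i
    by (rule e_xi_nonneg[OF pq(2) _ assms(10,11,13) ab(2)], rule Upos, assumption)+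
  have v: "?v i \<ge> 0" "?v 0 > 0" for i
    by (rule e_nu_nonneg[OF pq(1) _ assms(8,9,12) ab(1)], rule Lpos, assumption)+
  have supp: "i \<ge> Suc N \<Longrightarrow> ?u i = 0" "i \<ge> Suc N \<Longrightarrow> ?v i = 0" for i
    using N by (auto simp: e_xi_def e_nu_def)
  note dich = precision_degree_dichotomy[OF T nonneg near u(1,2) _ v(1,2) _ gap_def pd]
  show "(\<forall>n \<le> precision_degree p q T \<nu> \<xi> b a N. ?I n = ?S n) \<and>
     (\<forall>n > precision_degree p q T \<nu> \<xi> b a N. ?I n - ?S n > 0)"
  proof (intro conjI allI impI)
    fix n assume "n \<le> precision_degree p q T \<nu> \<xi> b a N"
    then have "gap n = 0" using supp by (intro dich(1))
    then show "?I n = ?S n" unfolding gap[symmetric] by (simp only: right_minus_eq)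
  next
    fix n assume "n > precision_degree p q T \<nu> \<xi> b a N"
    then show "?I n - ?S n > 0" unfolding gap using supp by (intro dich(2))
  qed
qed

end
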